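(* (A) For an arbitrary infinite set $Y$ of positive reals let $\mathfrak m(Y)$ be the least upper bound (in the class of cardinals) of all cardinals of the form $2^{\mathrm{card}(Y\cap(0,N))}$ where $N=1,2,\ldots$ Then: • $\mathrm{card}(X)\leq\mathfrak m(Y)$ for any AB-HO metric space $(X,d)$ with $d(X\times X)\subset Y\cup\{0\}$; and • there exists an AB-HO complete metric space $(X,d)$ such that $d(X\times X)=Y\cup\{0\}$ and $\mathrm{card}(X)=\mathfrak m(Y)$. (B) If $Y\subset(0,\infty)$ is an infinite bounded set, then there exists an AB-HO complete metric space $(X,d)$ such that $d(X\times X)=Y\cup\{0\}$ and $\mathrm{card}(X)=2^{\mathrm{card}(Y)}$. More generally, the same conclusion holds if $Y\subset(0,\infty)$ is infinite and there is $c>0$ such that $\mathrm{card}(Y\cap(0,c))=\mathrm{card}(Y)$ (e.g. if $\mathrm{card}(Y)=2^{\aleph_0}$). (C) Let $Y\subset(0,\infty)$ be an infinite set that is discrete in $\mathbb R$ (that is, $Y=\{a_n: n>0\}$ where $a_n>0$ and $\lim_{n\to\infty}a_n=\infty$). Any AB-HO metric space $(X,d)$ with $d(X\times X)\subset Y\cup\{0\}$ is Heine-Borel and at most countable.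
   Context: A metric space is absolutely homogeneous (AB-HO) if every isometric map from a subset of it into it extends to an isometry of the space onto itself. A metric space is Heine-Borel if all its closed balls are compact. *)

theory Defs
  imports "HOL-Analysis.Analysis"
begin

unbundle cardinal_syntax
no_notation elt_set_eq (infix \<open>=o\<close> 50)

definition isometric_on :: "'a set \<Rightarrow> ('a \<Rightarrow> 'a \<Rightarrow> real) \<Rightarrow> ('a \<Rightarrow> 'a) \<Rightarrow> bool" where
  "isometric_on A d f \<longleftrightarrow> (\<forall>x\<in>A. \<forall>y\<in>A. d (f x) (f y) = d x y)"

definition AB_HO :: "'a set \<Rightarrow> ('a \<Rightarrow> 'a \<Rightarrow> real) \<Rightarrow> bool" where
  "AB_HO X d \<longleftrightarrow>
    (\<forall>A f. A \<subseteq> X \<and> f ` A \<subseteq> X \<and> isometric_on A d f \<longrightarrow>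
       (\<exists>g. g ` X = X \<and> isometric_on X d g \<and> (\<forall>a\<in>A. g a = f a)))"

definition Heine_Borel_space :: "'a set \<Rightarrow> ('a \<Rightarrow> 'a \<Rightarrow> real) \<Rightarrow> bool" where
  "Heine_Borel_space X d \<longleftrightarrow>
    (\<forall>x\<in>X. \<forall>r. compactin (Metric_space.mtopology X d) (Metric_space.mcball X d x r))"

definition distance_set :: "'a set \<Rightarrow> ('a \<Rightarrow> 'a \<Rightarrow> real) \<Rightarrow> real set" where
  "distance_set X d = (\<lambda>(x, y). d x y) ` (X \<times> X)"

definition is_card_lub :: "'b rel set \<Rightarrow> 'b rel \<Rightarrow> bool" where
  "is_card_lub R k \<longleftrightarrow>
    Card_order k \<and> (\<forall>r\<in>R. r \<le>o k) \<and> (\<forall>t :: 'b rel. Card_order t \<and> (\<forall>r\<in>R. r \<le>o t) \<longrightarrow> k \<le>o t)"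

definition mY_powers :: "real set \<Rightarrow> (real \<Rightarrow> bool) rel set" where
  "mY_powers Y = {BNF_Cardinal_Arithmetic.ctwo ^c |Y \<inter> {0<..<real N}| | N::nat. N \<ge> 1}"

(* The least upper bound of a set of cardinals is determined only up to =o; the choice below
   picks one representative. It exists by mY_is_lub, and by mY_least it is least among all
   upper bounds on arbitrary types, not only among those on the type real => bool. *)
definition mY :: "real set \<Rightarrow> (real \<Rightarrow> bool) rel" where
  "mY Y = (SOME k. is_card_lub (mY_powers Y) k)"

lemma card_lub_exists:
  fixes R :: "'b rel set"
  assumes "\<And>r. r \<in> R \<Longrightarrow> Card_order r"
  shows "\<exists>k. is_card_lub R k"
proof -
  let ?U = "{t :: 'b rel. Card_order t \<and> (\<forall>r\<in>R. r \<le>o t)}"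
  have "r \<le>o |UNIV :: 'b set|" if "r \<in> R" for r
    by (rule ordIso_ordLeq_trans[OF ordIso_symmetric[OF card_of_Field_ordIso[OF assms[OF that]]]
          card_of_mono1[OF subset_UNIV]])
  then have "|UNIV :: 'b set| \<in> ?U"
    using card_of_Card_order by blast
  then have "\<exists>k\<in>?U. \<forall>t. (t, k) \<in> ordLess \<longrightarrow> t \<notin> ?U"
    by (rule wf_ordLess[unfolded wf_eq_minimal, rule_format])
  then obtain k where k: "k \<in> ?U" and m: "\<And>t. t <o k \<Longrightarrow> t \<notin> ?U"
    by auto
  have "k \<le>o t" if t: "t \<in> ?U" for t
  proof -
    have "Well_order k" "Well_order t"
      using k t by (simp_all add: card_order_on_well_order_on)
    moreover have "\<not> t <o k" using m t by blast
    ultimately show ?thesis using not_ordLess_iff_ordLeq by blast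
  qed
  with k have "is_card_lub R k" by (auto simp: is_card_lub_def)
  then show ?thesis ..
qed

lemma mY_is_lub: "is_card_lub (mY_powers Y) (mY Y)"
proof -
  have "\<exists>k. is_card_lub (mY_powers Y) k"
    by (rule card_lub_exists) (auto simp: mY_powers_def Card_order_cexp)
  then show ?thesis unfolding mY_def by (rule someI_ex)
qed

lemma mY_least:
  assumes t: "Card_order t" and ub: "\<And>r. r \<in> mY_powers Y \<Longrightarrow> r \<le>o t"
  shows "mY Y \<le>o t"
proof (rule ccontr)
  have k: "Card_order (mY Y)"
    using mY_is_lub by (auto simp: is_card_lub_def)
  assume "\<not> mY Y \<le>o t"
  then have less: "t <o mY Y"
    using not_ordLeq_iff_ordLess[OF card_order_on_well_order_on[OF t]
        card_order_on_well_order_on[OF k]] by simp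
  then obtain p :: "(real \<Rightarrow> bool) rel" where p: "t =o p" "p <o mY Y"
    using iffD1[OF internalize_ordLess less] by blast
  have "Card_order p"
    by (rule Card_order_ordIso[OF t ordIso_symmetric[OF p(1)]])
  moreover have "\<forall>r\<in>mY_powers Y. r \<le>o p"
    by (auto intro: ordLeq_ordIso_trans[OF ub p(1)])
  ultimately have "mY Y \<le>o p"
    using mY_is_lub by (auto simp: is_card_lub_def)
  then show False
    using not_ordLess_ordLeq[OF p(2)] by simp
qed

end

theory Submission
  imports Defs "HOL-Library.Ramsey"
begin

text \<open>
  \<^emph>\<open>Upper bounds.\<close> In an absolutely homogeneous space every isometric embedding of the space into
  itself, being its own only extension, is onto. Hence there is no infinite equilateral set: a shift
  of a maximal one to a proper part of itself is isometric, and no surjective isometry can extend it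
  (\<open>AB_HO_equilateral_finite\<close>). Colour the pairs of points by their distance. A ball of radius \<open>r\<close>
  uses only colours in \<open>Y \<inter> (0, 2r)\<close> and has no infinite monochromatic set. If these colours are
  finitely many, Ramsey's theorem makes the ball finite; this gives the statement on discrete \<open>Y\<close>. If
  there are \<open>\<kappa> \<ge> \<aleph>\<^sub>0\<close> of them, an Erdos--Rado argument (\<open>card_le_Pow_colours\<close>) leaves at most
  \<open>2\<^sup>\<kappa>\<close> points. The space is a countable union of balls, and \<open>mY Y\<close> is infinite.

  \<^emph>\<open>Construction.\<close> The points are the subsets of \<open>Y\<close> that are bounded above, and the distance of two
  of them is the first element of \<open>Y\<close>, in a suitable linear order, at which they differ. The space is
  a set of branches of a binary tree. A partial isometry is a partial automorphism of this tree,
  and it extends because at each node there are only two children: either the isometry prescribes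
  whether to swap them, or one keeps them (\<open>twist\<close>). Among the three first differences of three
  sets, two coincide and the third one is not earlier; so the triangle inequality holds as soon as
  \<open>a\<close> before \<open>b\<close> implies \<open>b < 2a\<close>. A decreasing order would do this, but it is not well-founded enough
  for first differences to exist. The order used here lists the octaves \<open>[2\<^sup>k, 2\<^sup>k\<^sup>+\<^sup>1)\<close> from high to
  low and well-orders each octave by choice (\<open>octave_order_exists\<close>). The bounded sets are the union
  of the power sets of the cuts \<open>Y \<inter> (0, n)\<close>, so they number \<open>mY Y\<close>.

  \<^emph>\<open>Power of the cardinal.\<close> If some cut of \<open>Y\<close> already has the cardinality of \<open>Y\<close>, then \<open>mY Y\<close> is
  \<open>2\<close> to the power \<open>|Y|\<close> (\<open>mY_eq_power\<close>). For \<open>Y\<close> of the cardinality of the continuum there is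
  such a cut because the continuum is not a countable supremum of smaller cardinals
  (\<open>continuum_cut\<close>).
\<close>


section \<open>Equilateral sets in absolutely homogeneous spaces\<close>

definition monochromatic :: "('a \<Rightarrow> 'a \<Rightarrow> 'c) \<Rightarrow> 'c \<Rightarrow> 'a set \<Rightarrow> bool" where
  "monochromatic col c H \<longleftrightarrow> (\<forall>x\<in>H. \<forall>y\<in>H. x \<noteq> y \<longrightarrow> col x y = c)"

lemma monochromaticD:
  "monochromatic col c H \<Longrightarrow> x \<in> H \<Longrightarrow> y \<in> H \<Longrightarrow> x \<noteq> y \<Longrightarrow> col x y = c"
  unfolding monochromatic_def by blast

lemma maximal_monochromatic:
  assumes "monochromatic col c E" "E \<subseteq> X"
  obtains M where "E \<subseteq> M" "M \<subseteq> X" "monochromatic col c M"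
    "\<And>b. b \<in> X \<Longrightarrow> monochromatic col c (insert b M) \<Longrightarrow> b \<in> M"
proof -
  let ?F = "{M. E \<subseteq> M \<and> M \<subseteq> X \<and> monochromatic col c M}"
  have "\<exists>M\<in>?F. \<forall>K\<in>?F. M \<subseteq> K \<longrightarrow> K = M"
  proof (rule subset_Zorn_nonempty)
    show "?F \<noteq> {}" using assms by blast
    fix C assume C: "C \<noteq> {}" "subset.chain ?F C"
    have "monochromatic col c (\<Union>C)"
      unfolding monochromatic_def
    proof (intro ballI impI)
      fix x y assume "x \<in> \<Union>C" "y \<in> \<Union>C" and ne: "x \<noteq> y"
      then obtain K L where KL: "K \<in> C" "L \<in> C" "x \<in> K" "y \<in> L" by blast
      then have "K \<subseteq> L \<or> L \<subseteq> K"
        using C(2) unfolding subset_chain_def by blast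
      then obtain N where N: "N \<in> C" "x \<in> N" "y \<in> N" using KL by blast
      then have "monochromatic col c N" using C(2) unfolding subset_chain_def by blast
      then show "col x y = c" using N(2,3) ne by (rule monochromaticD)
    qed
    moreover have "E \<subseteq> \<Union>C" "\<Union>C \<subseteq> X"
      using C unfolding subset_chain_def by blast+
    ultimately show "\<Union>C \<in> ?F" by blast
  qed
  then obtain M where M: "M \<in> ?F" and "\<forall>K\<in>?F. M \<subseteq> K \<longrightarrow> K = M"
    by (rule bexE)
  then have max: "K = M" if "K \<in> ?F" "M \<subseteq> K" for K
    using that by simp
  have "b \<in> M" if "b \<in> X" "monochromatic col c (insert b M)" for b
  proof -
    have "insert b M \<in> ?F" using M that by auto
    then have "insert b M = M" by (rule max) auto
    then show ?thesis by blast
  qed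
  with M show thesis using that[of M] by simp
qed

text \<open>
  Otherwise enlarge the equilateral set to a maximal one \<open>M\<close>. Every injection of \<open>M\<close> into itself is
  isometric, so a bijection of \<open>M\<close> onto \<open>M - {a}\<close> extends to a surjective isometry \<open>g\<close>. The point
  that \<open>g\<close> sends to \<open>a\<close> then lies outside \<open>M\<close> and is equidistant from all of \<open>M\<close>, which contradicts
  maximality.
\<close>

lemma AB_HO_equilateral_finite:
  assumes met: "Metric_space X d" and hom: "AB_HO X d"
    and E: "E \<subseteq> X" "monochromatic d c E"
  shows "finite E"
proof (rule ccontr)
  assume inf: "infinite E"
  interpret Metric_space X d by (fact met)
  obtain M where M: "E \<subseteq> M" "M \<subseteq> X" "monochromatic d c M"
    and max: "\<And>b. b \<in> X \<Longrightarrow> monochromatic d c (insert b M) \<Longrightarrow> b \<in> M"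
    by (rule maximal_monochromatic[OF E(2,1)]) (rule that)
  have infM: "infinite M" using inf finite_subset[OF M(1)] by blast
  then have "M \<noteq> {}" by auto
  then obtain a where a: "a \<in> M" by blast
  obtain h where h: "bij_betw h M (M - {a})" using infinite_imp_bij_betw[OF infM, of a] by blast
  have hM: "h ` M = M - {a}" and hinj: "inj_on h M"
    using h by (auto simp: bij_betw_def)
  have "isometric_on M d h"
    unfolding isometric_on_def
  proof (intro ballI)
    fix x y assume xy: "x \<in> M" "y \<in> M"
    show "d (h x) (h y) = d x y"
    proof (cases "x = y")
      case True
      moreover have "h x \<in> X" "x \<in> X" using xy M(2) hM by auto
      ultimately show ?thesis by simp
    next
      case False
      moreover from this have "h x \<noteq> h y" using xy hinj by (auto dest: inj_onD)
      moreover have "h x \<in> M" "h y \<in> M" using hM xy by auto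
      ultimately have "d (h x) (h y) = c" "d x y = c"
        using monochromaticD[OF M(3)] xy False by simp_all
      then show ?thesis by simp
    qed
  qed
  moreover have "h ` M \<subseteq> X" using M(2) hM by blast
  ultimately have "\<exists>g. g ` X = X \<and> isometric_on X d g \<and> (\<forall>x\<in>M. g x = h x)"
    using hom[unfolded AB_HO_def, rule_format, of M h] M(2) by simp
  then obtain g where g: "g ` X = X" "isometric_on X d g" "\<And>x. x \<in> M \<Longrightarrow> g x = h x"
    by blast
  have "a \<in> g ` X" using g(1) a M(2) by blast
  then obtain b where b: "b \<in> X" "g b = a" by blast
  have dist: "d b m = c" if m: "m \<in> M" for m
  proof -
    have hm: "h m \<in> M" "h m \<noteq> a" using hM m by auto
    have "d b m = d (g b) (g m)"
      using g(2) b(1) m M(2) by (auto simp: isometric_on_def)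
    also have "\<dots> = d a (h m)" using g(3) m b by simp
    also have "\<dots> = c" using monochromaticD[OF M(3) a hm(1)] hm(2) by simp
    finally show ?thesis .
  qed
  have "monochromatic d c (insert b M)"
    unfolding monochromatic_def
  proof (intro ballI impI)
    fix x y assume xy: "x \<in> insert b M" "y \<in> insert b M" "x \<noteq> y"
    have "d m b = c" if "m \<in> M" for m
      using dist[OF that] commute[of m b] by simp
    moreover have "d x y = c" if "x \<in> M" "y \<in> M"
      using monochromaticD[OF M(3) that xy(3)] .
    ultimately show "d x y = c"
      using dist xy by auto
  qed
  then have "b \<in> M" by (rule max[OF b(1)])
  then have "g b \<in> M - {a}" using g(3) hM by auto
  then show False using b by simp
qed


section \<open>Colourings without infinite monochromatic sets\<close>

text \<open>
  A point \<open>y\<close> before \<open>x\<close> is on the path of \<open>x\<close> if the members of the path before \<open>y\<close> cannot tell \<open>y\<close>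
  from \<open>x\<close> by their colours. These paths are the branches of the Erdos--Rado tree of the colouring.
\<close>

definition path :: "('a \<times> 'a) set \<Rightarrow> ('a \<Rightarrow> 'a \<Rightarrow> 'c) \<Rightarrow> 'a \<Rightarrow> 'a set" where
  "path R col x = {y. wfrec R (\<lambda>F y. (y, x) \<in> R \<and> (\<forall>z. (z, y) \<in> R \<longrightarrow> F z \<longrightarrow> col z y = col z x)) y}"

text \<open>
  The number of earlier occurrences of a colour separates the members of the path that share it.
\<close>

definition path_label :: "('a \<times> 'a) set \<Rightarrow> ('a \<Rightarrow> 'a \<Rightarrow> 'c) \<Rightarrow> 'a \<Rightarrow> 'a \<Rightarrow> 'c \<times> nat" where
  "path_label R col x z = (col z x, card {w \<in> path R col x. (w, z) \<in> R \<and> col w x = col z x})"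

text \<open>
  The order of the path with its points forgotten: only the labels are kept.
\<close>

definition path_code ::
  "('a \<times> 'a) set \<Rightarrow> ('a \<Rightarrow> 'a \<Rightarrow> 'c) \<Rightarrow> 'a \<Rightarrow> (('c \<times> nat) \<times> ('c \<times> nat)) set" where
  "path_code R col x = {(path_label R col x z, path_label R col x w) | z w.
     z \<in> path R col x \<and> w \<in> path R col x \<and> ((z, w) \<in> R \<or> z = w)}"

locale well_ordered_colouring =
  fixes B :: "'a set" and R :: "('a \<times> 'a) set" and col :: "'a \<Rightarrow> 'a \<Rightarrow> 'c"
  assumes wf: "wf R" and transR: "trans R" and total: "total_on B R" and RB: "R \<subseteq> B \<times> B"
    and sym: "col x y = col y x"
    and mono_finite: "H \<subseteq> B \<Longrightarrow> monochromatic col c H \<Longrightarrow> finite H"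
begin

abbreviation P where "P \<equiv> path R col"
abbreviation lab where "lab \<equiv> path_label R col"
abbreviation code where "code \<equiv> path_code R col"

lemma irrefl: "(x, x) \<notin> R"
  using wf by (metis wf_not_refl)

lemma path_iff: "y \<in> P x \<longleftrightarrow> (y, x) \<in> R \<and> (\<forall>z\<in>P x. (z, y) \<in> R \<longrightarrow> col z y = col z x)"
proof -
  define W where
    "W = wfrec R (\<lambda>F y. (y, x) \<in> R \<and> (\<forall>z. (z, y) \<in> R \<longrightarrow> F z \<longrightarrow> col z y = col z x))"
  have "W y \<longleftrightarrow> (y, x) \<in> R \<and> (\<forall>z. (z, y) \<in> R \<longrightarrow> cut W R y z \<longrightarrow> col z y = col z x)"
    using def_wfrec[OF eq_reflection[OF W_def] wf, of y] .
  also have "\<dots> \<longleftrightarrow> (y, x) \<in> R \<and> (\<forall>z. (z, y) \<in> R \<longrightarrow> W z \<longrightarrow> col z y = col z x)"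
    by (simp add: cut_apply cong: imp_cong)
  finally have W: "W y \<longleftrightarrow> (y, x) \<in> R \<and> (\<forall>z. (z, y) \<in> R \<longrightarrow> W z \<longrightarrow> col z y = col z x)" .
  have P: "z \<in> P x \<longleftrightarrow> W z" for z
    by (simp add: path_def W_def)
  show ?thesis
    unfolding Ball_def P by (subst W) blast
qed

lemma path_before: "y \<in> P x \<Longrightarrow> (y, x) \<in> R"
  using path_iff[THEN iffD1] ..

lemma path_subset: "P x \<subseteq> B"
  using path_before RB by blast

lemma path_colour: "y \<in> P x \<Longrightarrow> z \<in> P x \<Longrightarrow> (z, y) \<in> R \<Longrightarrow> col z y = col z x"
  using path_iff[THEN iffD1, THEN conjunct2, rule_format] .

lemma path_linear: "y \<in> P x \<Longrightarrow> z \<in> P x \<Longrightarrow> y = z \<or> (y, z) \<in> R \<or> (z, y) \<in> R"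
  using total path_subset unfolding total_on_def by blast

lemma path_coherent:
  assumes y: "y \<in> P x"
  shows "(z, y) \<in> R \<Longrightarrow> z \<in> P y \<longleftrightarrow> z \<in> P x"
proof (induction z rule: wf_induct_rule[OF wf])
  case (1 z)
  have zx: "(z, x) \<in> R" using 1(2) path_before[OF y] transR by (meson transD)
  have eq: "w \<in> P y \<longleftrightarrow> w \<in> P x" "w \<in> P x \<Longrightarrow> col w y = col w x" if "(w, z) \<in> R" for w
  proof -
    have wy: "(w, y) \<in> R" using that 1(2) transR by (meson transD)
    then show "w \<in> P y \<longleftrightarrow> w \<in> P x" using 1(1) that by blast
    show "w \<in> P x \<Longrightarrow> col w y = col w x" using path_colour[OF y _ wy] .
  qed
  have "z \<in> P y \<longleftrightarrow> (\<forall>w\<in>P y. (w, z) \<in> R \<longrightarrow> col w z = col w y)"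
    using path_iff[of z y] 1(2) by simp
  also have "\<dots> \<longleftrightarrow> (\<forall>w. w \<in> P x \<and> (w, z) \<in> R \<longrightarrow> col w z = col w x)"
  proof (intro iffI allI ballI impI)
    fix w assume *: "\<forall>w\<in>P y. (w, z) \<in> R \<longrightarrow> col w z = col w y" and w: "w \<in> P x \<and> (w, z) \<in> R"
    then have "col w z = col w y" using eq(1) by simp
    then show "col w z = col w x" using eq(2) w by simp
  next
    fix w assume *: "\<forall>w. w \<in> P x \<and> (w, z) \<in> R \<longrightarrow> col w z = col w x" and w: "w \<in> P y" "(w, z) \<in> R"
    then have "w \<in> P x" using eq(1) by simp
    then show "col w z = col w y" using * eq(2) w(2) by simp
  qed
  also have "\<dots> \<longleftrightarrow> z \<in> P x"
    using path_iff[of z x] zx by auto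
  finally show ?case .
qed

lemma path_of_member:
  assumes "y \<in> P x"
  shows "P y = {z \<in> P x. (z, y) \<in> R}"
  using path_coherent[OF assms] path_before[of _ y] by blast

text \<open>
  If \<open>x\<close> preceded \<open>x'\<close>, the hypotheses would put \<open>x\<close> on the path of \<open>x'\<close>, hence on its own path.
\<close>

lemma path_determines:
  assumes "x \<in> B" "x' \<in> B" "P x = P x'" "\<And>z. z \<in> P x \<Longrightarrow> col z x = col z x'"
  shows "x = x'"
proof -
  have False if "(x, x') \<in> R" "P x = P x'" "\<And>z. z \<in> P x \<Longrightarrow> col z x = col z x'" for x x'
  proof -
    have "x \<in> P x'" using that path_iff[of x x'] by simp
    then show False using that(2) path_before irrefl by blast
  qed
  from this[of x x'] this[of x' x] assms(3,4) have "(x, x') \<notin> R" "(x', x) \<notin> R"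
    by auto
  then show ?thesis using total assms(1,2) unfolding total_on_def by blast
qed

lemma colour_class_finite: "finite {z \<in> P x. col z x = c}"
proof (rule mono_finite[where c = c])
  show "{z \<in> P x. col z x = c} \<subseteq> B" using path_subset by blast
  show "monochromatic col c {z \<in> P x. col z x = c}"
    unfolding monochromatic_def
  proof (intro ballI impI)
    fix y z assume yz: "y \<in> {z \<in> P x. col z x = c}" "z \<in> {z \<in> P x. col z x = c}" "y \<noteq> z"
    then consider "(y, z) \<in> R" | "(z, y) \<in> R" using path_linear by blast
    then show "col y z = c"
    proof cases
      case 1
      then show ?thesis using path_colour[of z x y] yz by simp
    next
      case 2
      then show ?thesis using path_colour[of y x z] yz sym[of y z] by simp
    qed
  qed
qed

lemma label_inj: "inj_on (lab x) (P x)"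
proof -
  have less: "lab x z \<noteq> lab x z'" if z: "z \<in> P x" and R: "(z, z') \<in> R" for z z'
  proof
    assume eq: "lab x z = lab x z'"
    let ?S = "\<lambda>z. {w \<in> P x. (w, z) \<in> R \<and> col w x = col z x}"
    have c: "col z x = col z' x" and card: "card (?S z) = card (?S z')"
      using eq by (auto simp: path_label_def)
    have "finite (?S z')"
      by (rule finite_subset[OF _ colour_class_finite[of x "col z' x"]]) blast
    moreover have "?S z \<subseteq> ?S z'" using transR R c by (auto dest: transD)
    moreover have "z \<in> ?S z'" "z \<notin> ?S z" using z R c irrefl by auto
    ultimately have "card (?S z) < card (?S z')" by (intro psubset_card_mono) auto
    then show False using card by simp
  qed
  show ?thesis
  proof (rule inj_onI, rule ccontr)
    fix z z' assume "z \<in> P x" "z' \<in> P x" "lab x z = lab x z'" "z \<noteq> z'"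
    then show False using less[of z z'] less[of z' z] path_linear[of z x z'] by auto
  qed
qed

lemma code_memberI:
  "z \<in> P x \<Longrightarrow> w \<in> P x \<Longrightarrow> (z, w) \<in> R \<or> z = w \<Longrightarrow> (lab x z, lab x w) \<in> code x"
  unfolding path_code_def by blast

lemma code_memberE:
  assumes "(a, b) \<in> code x"
  obtains z w where "a = lab x z" "b = lab x w" "z \<in> P x" "w \<in> P x" "(z, w) \<in> R \<or> z = w"
  using assms unfolding path_code_def by blast

text \<open>
  An equality of codes is an order isomorphism between the two paths. Such an isomorphism fixes every
  point: if it fixes all the points before \<open>z\<close>, then \<open>z\<close> and its image have the same path with the
  same colours, and so coincide.
\<close>

lemma code_eq_path:
  assumes code: "code x = code x'"
  shows "z \<in> P x \<Longrightarrow> z \<in> P x' \<and> lab x' z = lab x z"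
proof (induction z rule: wf_induct_rule[OF wf])
  case (1 z)
  note z = 1(2)
  have IH: "w \<in> P x' \<and> lab x' w = lab x w" if "(w, z) \<in> R" "w \<in> P x" for w
    using 1(1) that by blast
  have inj: "w = v" if "lab x w = lab x v" "w \<in> P x" "v \<in> P x" for w v
    using label_inj[of x] that by (auto dest: inj_onD)
  have inj': "w = v" if "lab x' w = lab x' v" "w \<in> P x'" "v \<in> P x'" for w v
    using label_inj[of x'] that by (auto dest: inj_onD)
  have "(lab x z, lab x z) \<in> code x'"
    using code_memberI[OF z z] code by simp
  then obtain u where u: "u \<in> P x'" "lab x' u = lab x z"
    by (elim code_memberE) simp
  have sub: "w \<in> P u" if w: "w \<in> P z" for w
  proof -
    have w': "w \<in> P x" "(w, z) \<in> R" using w path_of_member[OF z] by auto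
    have "(lab x w, lab x z) \<in> code x'"
      using code_memberI[OF w'(1) z] w'(2) code by simp
    then obtain v t where vt: "lab x w = lab x' v" "lab x z = lab x' t"
      "v \<in> P x'" "t \<in> P x'" "(v, t) \<in> R \<or> v = t"
      by (elim code_memberE)
    have "v = w" "t = u" using inj' vt u IH[OF w'(2,1)] by simp_all
    moreover have "w \<noteq> u" using u(2) IH[OF w'(2,1)] inj[of w z] w' z irrefl by auto
    ultimately show "w \<in> P u" using vt path_of_member[OF u(1)] by auto
  qed
  have sup: "v \<in> P z" if v: "v \<in> P u" for v
  proof -
    have v': "v \<in> P x'" "(v, u) \<in> R" using v path_of_member[OF u(1)] by auto
    have "(lab x' v, lab x' u) \<in> code x"
      using code_memberI[OF v'(1) u(1)] v'(2) code by simp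
    then obtain w t where wt: "lab x' v = lab x w" "lab x' u = lab x t"
      "w \<in> P x" "t \<in> P x" "(w, t) \<in> R \<or> w = t"
      by (elim code_memberE)
    have "t = z" using inj wt u z by simp
    moreover have "w \<noteq> z" using wt(1) u inj'[of v u] v' irrefl by auto
    ultimately have wz: "(w, z) \<in> R" using wt by auto
    then have "w = v" using IH[OF wz wt(3)] wt(1) inj' v' by simp
    then show "v \<in> P z" using wz wt path_of_member[OF z] by auto
  qed
  have "z = u"
  proof (rule path_determines)
    show "z \<in> B" "u \<in> B" using z u path_subset by auto
    show "P z = P u" using sub sup by blast
    fix w assume w: "w \<in> P z"
    then have w': "w \<in> P x" "(w, z) \<in> R" using path_of_member[OF z] by auto
    have "w \<in> P x'" "(w, u) \<in> R" using sub[OF w] path_of_member[OF u(1)] by auto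
    then have "col w u = col w x'" using path_colour u(1) by blast
    moreover have "col w z = col w x" using path_colour z w' by blast
    moreover have "col w x = col w x'" using IH[OF w'(2,1)] by (simp add: path_label_def)
    ultimately show "col w z = col w u" by simp
  qed
  then show ?case using u by simp
qed

lemma code_inj: "inj_on code B"
proof
  fix x x' assume x: "x \<in> B" "x' \<in> B" and code: "code x = code x'"
  show "x = x'"
  proof (rule path_determines[OF x])
    show "P x = P x'" using code_eq_path[OF code] code_eq_path[OF code[symmetric]] by blast
    fix z assume "z \<in> P x"
    then show "col z x = col z x'" using code_eq_path[OF code] by (simp add: path_label_def)
  qed
qed

end

lemma card_of_Pow_le: "|A| \<le>o |B| \<Longrightarrow> |Pow A| \<le>o |Pow B|"
proof -
  assume "|A| \<le>o |B|"
  then obtain f where f: "inj_on f A" "f ` A \<subseteq> B"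
    using iffD2[OF card_of_ordLeq] by blast
  then have "inj_on (image f) (Pow A) \<and> image f ` Pow A \<subseteq> Pow B"
    using inj_on_image_Pow[OF f(1)] by auto
  then show ?thesis by (rule iffD1[OF card_of_ordLeq exI])
qed

text \<open>
  This is the Erdos--Rado theorem for pairs, weakened to infinite monochromatic sets. Points of one
  colour on a path form a monochromatic set, so a path meets each colour finitely often; it then fits
  inside \<open>C \<times> nat\<close>, and the point is coded by a relation on that set.
\<close>

lemma card_le_Pow_colours:
  fixes B :: "'a set" and col :: "'a \<Rightarrow> 'a \<Rightarrow> 'c"
  assumes sym: "\<And>x y. col x y = col y x"
    and C: "infinite C" "\<And>x y. x \<in> B \<Longrightarrow> y \<in> B \<Longrightarrow> x \<noteq> y \<Longrightarrow> col x y \<in> C"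
    and fin: "\<And>c H. H \<subseteq> B \<Longrightarrow> monochromatic col c H \<Longrightarrow> finite H"
  shows "|B| \<le>o |Pow C|"
proof -
  obtain r where r: "well_order_on B r" using well_order_on by blast
  let ?R = "r - Id"
  have lin: "linear_order_on B r" and wf: "wf ?R"
    using r by (auto simp: well_order_on_def)
  have "trans r" "antisym r" "total_on B r" "r \<subseteq> B \<times> B"
    using lin unfolding linear_order_on_def partial_order_on_def preorder_on_def by simp_all
  then have R: "trans ?R" "total_on B ?R" "?R \<subseteq> B \<times> B"
    by (simp_all add: trans_diff_Id) blast
  interpret well_ordered_colouring B ?R col
    by (rule well_ordered_colouring.intro[OF wf R sym fin])
  let ?D = "(C \<times> (UNIV :: nat set)) \<times> (C \<times> (UNIV :: nat set))"
  have "code x \<subseteq> ?D" if x: "x \<in> B" for x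
  proof -
    have labC: "lab x z \<in> C \<times> UNIV" if "z \<in> P x" for z
    proof -
      have "z \<in> B" "z \<noteq> x" using subsetD[OF path_subset that] path_before[OF that] by simp_all
      then show ?thesis using C(2)[of z x] x by (simp add: path_label_def)
    qed
    show ?thesis
    proof
      fix p assume "p \<in> code x"
      then obtain z w where "p = (lab x z, lab x w)" "z \<in> P x" "w \<in> P x"
        unfolding path_code_def by auto
      then show "p \<in> ?D" using labC by simp
    qed
  qed
  then have "inj_on code B \<and> code ` B \<subseteq> Pow ?D"
    using code_inj by (simp add: image_subset_iff)
  then have "|B| \<le>o |Pow ?D|"
    by (rule iffD1[OF card_of_ordLeq exI])
  also have "|Pow ?D| \<le>o |Pow C|"
  proof -
    have C': "|C \<times> (UNIV :: nat set)| =o |C|"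
      by (rule card_of_Times_infinite_simps(1)[OF C(1) UNIV_not_empty])
        (rule iffD1[OF infinite_iff_card_of_nat C(1)])
    then have "infinite (C \<times> (UNIV :: nat set))"
      using card_of_ordIso_finite C(1) by blast
    then have "|?D| =o |C \<times> (UNIV :: nat set)|"
      by (rule card_of_Times_same_infinite)
    then have "|?D| \<le>o |C|"
      by (rule ordIso_imp_ordLeq[OF ordIso_transitive[OF _ C']])
    then show ?thesis by (rule card_of_Pow_le)
  qed
  finally show ?thesis .
qed

lemma finite_of_finite_colours:
  fixes B :: "'a set" and col :: "'a \<Rightarrow> 'a \<Rightarrow> 'c"
  assumes sym: "\<And>x y. col x y = col y x"
    and C: "finite C" "\<And>x y. x \<in> B \<Longrightarrow> y \<in> B \<Longrightarrow> x \<noteq> y \<Longrightarrow> col x y \<in> C"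
    and fin: "\<And>c H. H \<subseteq> B \<Longrightarrow> monochromatic col c H \<Longrightarrow> finite H"
  shows "finite B"
proof (rule ccontr)
  assume inf: "infinite B"
  from ex_bij_betw_finite_nat[OF C(1)]
  obtain idx where idx: "bij_betw idx C {0..<card C}" by blast
  define e where "e Z = (THE c. \<exists>x\<in>Z. \<exists>y\<in>Z. x \<noteq> y \<and> c = col x y)" for Z
  have e: "e {x, y} = col x y" if "x \<noteq> y" for x y
    unfolding e_def using that sym[of x y] by (intro the_equality) auto
  have "\<forall>x\<in>B. \<forall>y\<in>B. x \<noteq> y \<longrightarrow> (idx \<circ> e) {x, y} < card C"
  proof (intro ballI impI)
    fix x y assume "x \<in> B" "y \<in> B" "x \<noteq> y"
    then have "idx (col x y) \<in> {0..<card C}" using C(2) idx bij_betwE by blast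
    then show "(idx \<circ> e) {x, y} < card C" using e[OF \<open>x \<noteq> y\<close>] by simp
  qed
  from Ramsey2[OF inf this] obtain H t where H: "H \<subseteq> B" "infinite H"
    "\<And>x y. x \<in> H \<Longrightarrow> y \<in> H \<Longrightarrow> x \<noteq> y \<Longrightarrow> idx (e {x, y}) = t"
    by auto
  have "col x y = inv_into C idx t" if "x \<in> H" "y \<in> H" "x \<noteq> y" for x y
  proof -
    have "col x y \<in> C" using C(2) that H(1) by blast
    then have "inv_into C idx (idx (col x y)) = col x y" by (rule bij_betw_inv_into_left[OF idx])
    then show ?thesis using H(3)[OF that] e[OF that(3)] by simp
  qed
  then have "monochromatic col (inv_into C idx t) H" unfolding monochromatic_def by blast
  then show False using fin H by blast
qed


section \<open>The cardinal bound\<close>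

lemma Pow_cexp_ctwo: "|Pow A| =o ctwo ^c |A|"
  by (simp add: card_of_Pow_Func cexp_def ctwo_def Field_card_of)

lemma ctwo_power_le_mY:
  assumes "N \<ge> 1"
  shows "|Pow (Y \<inter> {0<..<real N})| \<le>o mY Y"
proof -
  have "ctwo ^c |Y \<inter> {0<..<real N}| \<in> mY_powers Y"
    using assms unfolding mY_powers_def by blast
  then have "ctwo ^c |Y \<inter> {0<..<real N}| \<le>o mY Y"
    using mY_is_lub[of Y] unfolding is_card_lub_def by blast
  then show ?thesis by (rule ordIso_ordLeq_trans[OF Pow_cexp_ctwo])
qed

lemma mY_Card_order: "Card_order (mY Y)"
  using mY_is_lub[of Y] unfolding is_card_lub_def by blast

lemma finite_subset_cut:
  fixes F :: "real set"
  assumes "finite F" "F \<subseteq> {0<..}"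
  obtains N :: nat where "N \<ge> 1" "F \<subseteq> {0<..<real N}"
proof -
  obtain b where b: "\<And>x. x \<in> F \<Longrightarrow> x \<le> b"
    using bdd_above_finite[OF assms(1)] unfolding bdd_above_def by blast
  obtain N where N: "b < real N" using reals_Archimedean2 by blast
  have "F \<subseteq> {0<..<real (Suc N)}"
  proof
    fix x assume "x \<in> F"
    then show "x \<in> {0<..<real (Suc N)}" using b[of x] N assms(2) by auto
  qed
  then show thesis by (intro that[of "Suc N"]) simp_all
qed

lemma mY_infinite:
  assumes "infinite Y" "Y \<subseteq> {0<..}"
  shows "infinite (Field (mY Y))"
proof
  assume fin: "finite (Field (mY Y))"
  obtain F where F: "F \<subseteq> Y" "finite F" "card F = Suc (card (Field (mY Y)))"
    using infinite_arbitrarily_large[OF assms(1)] by blast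
  have "F \<subseteq> {0<..}" using F(1) assms(2) by blast
  then obtain N :: nat where N: "N \<ge> 1" "F \<subseteq> {0<..<real N}"
    using finite_subset_cut[OF F(2)] by blast
  have "|F| \<le>o |Pow F|" by (rule ordLess_imp_ordLeq[OF card_of_Pow])
  also have "|Pow F| \<le>o |Pow (Y \<inter> {0<..<real N})|"
    using F(1) N(2) by (intro card_of_mono1) blast
  also have "|Pow (Y \<inter> {0<..<real N})| \<le>o mY Y" by (rule ctwo_power_le_mY[OF N(1)])
  also have "mY Y =o |Field (mY Y)|"
    by (rule ordIso_symmetric[OF card_of_Field_ordIso[OF mY_Card_order]])
  finally obtain f where f: "inj_on f F" "f ` F \<subseteq> Field (mY Y)"
    using iffD2[OF card_of_ordLeq] by blast
  then have "card F \<le> card (Field (mY Y))" using card_inj_on_le fin by blast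
  then show False using F(3) by simp
qed

lemma countable_union_le_mY:
  assumes "infinite Y" "Y \<subseteq> {0<..}" "\<And>n :: nat. |A n| \<le>o mY Y"
  shows "|\<Union>n. A n| \<le>o mY Y"
proof (rule card_of_UNION_ordLeq_infinite_Field[OF mY_infinite[OF assms(1,2)] mY_Card_order])
  have "|UNIV :: nat set| \<le>o |Field (mY Y)|"
    using mY_infinite[OF assms(1,2)] by (rule iffD1[OF infinite_iff_card_of_nat])
  then show "|UNIV :: nat set| \<le>o mY Y"
    by (rule ordLeq_ordIso_trans[OF _ card_of_Field_ordIso[OF mY_Card_order]])
  show "\<forall>n\<in>UNIV. |A n| \<le>o mY Y" using assms(3) by blast
qed

text \<open>
  Once a cut captures the full cardinality of \<open>Y\<close>, the later ones add nothing and the supremum is a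
  maximum.
\<close>

lemma mY_eq_power:
  assumes c: "|Y \<inter> {0<..<c}| =o |Y|"
  shows "mY Y =o ctwo ^c |Y|"
proof -
  obtain N :: nat where N: "c < real N" using reals_Archimedean2 by blast
  have "|Pow Y| \<le>o |Pow (Y \<inter> {0<..<real (Suc N)})|"
  proof (rule card_of_Pow_le)
    have "|Y| \<le>o |Y \<inter> {0<..<c}|" by (rule ordIso_imp_ordLeq[OF ordIso_symmetric[OF c]])
    also have "|Y \<inter> {0<..<c}| \<le>o |Y \<inter> {0<..<real (Suc N)}|" using N by (intro card_of_mono1) auto
    finally show "|Y| \<le>o |Y \<inter> {0<..<real (Suc N)}|" .
  qed
  also have "|Pow (Y \<inter> {0<..<real (Suc N)})| \<le>o mY Y" by (rule ctwo_power_le_mY) simp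
  finally have ge: "ctwo ^c |Y| \<le>o mY Y"
    by (rule ordIso_ordLeq_trans[OF ordIso_symmetric[OF Pow_cexp_ctwo]])
  have "mY Y \<le>o ctwo ^c |Y|"
  proof (rule mY_least[OF Card_order_cexp])
    fix r assume "r \<in> mY_powers Y"
    then obtain n :: nat where r: "r = ctwo ^c |Y \<inter> {0<..<real n}|"
      unfolding mY_powers_def by blast
    have "r \<le>o |Pow (Y \<inter> {0<..<real n})|"
      unfolding r by (rule ordIso_imp_ordLeq[OF ordIso_symmetric[OF Pow_cexp_ctwo]])
    also have "|Pow (Y \<inter> {0<..<real n})| \<le>o |Pow Y|" by (intro card_of_mono1) blast
    finally show "r \<le>o ctwo ^c |Y|" by (rule ordLeq_ordIso_trans[OF _ Pow_cexp_ctwo])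
  qed
  with ge show ?thesis by (simp add: ordIso_iff_ordLeq)
qed

lemma ball_distances:
  assumes "Metric_space X d" "distance_set X d \<subseteq> Y \<union> {0}" "x0 \<in> X"
    and "x \<in> {x \<in> X. d x0 x < r}" "y \<in> {x \<in> X. d x0 x < r}" "x \<noteq> y"
  shows "d x y \<in> Y \<inter> {0<..<2 * r}"
proof -
  interpret Metric_space X d by (fact assms(1))
  have xy: "x \<in> X" "y \<in> X" using assms by auto
  have "d x y \<in> distance_set X d" unfolding distance_set_def using xy by auto
  moreover have "0 < d x y" using xy assms(6) mdist_pos_less by blast
  moreover have "d x y \<le> d x0 x + d x0 y"
    using triangle[OF xy(1) assms(3) xy(2)] commute[of x x0] by simp
  ultimately show ?thesis using assms by auto
qed

text \<open>
  The pairs in the ball are coloured by their distances, and the monochromatic sets of this colouring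
  are equilateral, hence finite.
\<close>

lemma AB_HO_ball_card:
  assumes "Metric_space X d" "AB_HO X d" "distance_set X d \<subseteq> Y \<union> {0}" "x0 \<in> X"
  defines "B \<equiv> \<lambda>r. {x \<in> X. d x0 x < r}"
  shows AB_HO_ball_finite: "finite (Y \<inter> {0<..<2 * r}) \<Longrightarrow> finite (B r)"
    and AB_HO_ball_le: "infinite (Y \<inter> {0<..<2 * r}) \<Longrightarrow> |B r| \<le>o |Pow (Y \<inter> {0<..<2 * r})|"
proof -
  have sym: "d x y = d y x" for x y
    using Metric_space.commute[OF assms(1)] .
  have col: "d x y \<in> Y \<inter> {0<..<2 * r}" if "x \<in> B r" "y \<in> B r" "x \<noteq> y" for x y
    using ball_distances[OF assms(1,3,4)] that unfolding B_def by blast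
  have fin: "finite H" if "H \<subseteq> B r" "monochromatic d c H" for H c
    using AB_HO_equilateral_finite[OF assms(1,2) _ that(2)] that(1) unfolding B_def by blast
  show "finite (Y \<inter> {0<..<2 * r}) \<Longrightarrow> finite (B r)"
    by (rule finite_of_finite_colours[OF sym _ col fin])
  show "infinite (Y \<inter> {0<..<2 * r}) \<Longrightarrow> |B r| \<le>o |Pow (Y \<inter> {0<..<2 * r})|"
    by (rule card_le_Pow_colours[OF sym _ col fin])
qed

lemma union_balls:
  fixes d :: "'a \<Rightarrow> 'a \<Rightarrow> real"
  shows "X = (\<Union>n. {x \<in> X. d x0 x < real (Suc n)})"
proof -
  have "\<exists>n. d x0 x < real (Suc n)" for x
  proof -
    obtain n where "d x0 x < real n" using reals_Archimedean2 by blast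
    then show ?thesis by (intro exI[of _ n]) simp
  qed
  then show ?thesis by blast
qed

lemma AB_HO_card_le_mY:
  fixes X :: "'a set"
  assumes Y: "infinite Y" "Y \<subseteq> {0<..}"
    and X: "Metric_space X d" "AB_HO X d" "distance_set X d \<subseteq> Y \<union> {0}"
  shows "|X| \<le>o mY Y"
proof (cases "X = {}")
  case True
  have "|{} :: 'a set| \<le>o |Field (mY Y)|" by (rule card_of_empty)
  then show ?thesis
    unfolding True by (rule ordLeq_ordIso_trans[OF _ card_of_Field_ordIso[OF mY_Card_order]])
next
  case False
  then obtain x0 where x0: "x0 \<in> X" by blast
  have ball: "|{x \<in> X. d x0 x < real (Suc n)}| \<le>o mY Y" for n
  proof (cases "finite (Y \<inter> {0<..<2 * real (Suc n)})")
    case True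
    have "finite {x \<in> X. d x0 x < real (Suc n)}"
      by (rule AB_HO_ball_finite[OF X x0 True])
    then have "|{x \<in> X. d x0 x < real (Suc n)}| \<le>o |Field (mY Y)|"
      using mY_infinite[OF Y]
      by (intro ordLess_imp_ordLeq finite_ordLess_infinite[OF card_of_Well_order card_of_Well_order])
        (simp_all add: Field_card_of)
    then show ?thesis by (rule ordLeq_ordIso_trans[OF _ card_of_Field_ordIso[OF mY_Card_order]])
  next
    case False
    have "|{x \<in> X. d x0 x < real (Suc n)}| \<le>o |Pow (Y \<inter> {0<..<2 * real (Suc n)})|"
      by (rule AB_HO_ball_le[OF X x0 False])
    also have "|Pow (Y \<inter> {0<..<2 * real (Suc n)})| \<le>o mY Y"
      using ctwo_power_le_mY[of "2 * Suc n" Y] by simp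
    finally show ?thesis .
  qed
  have "|\<Union>n. {x \<in> X. d x0 x < real (Suc n)}| \<le>o mY Y"
    by (rule countable_union_le_mY[OF Y ball])
  then show ?thesis using union_balls[of X d x0] by simp
qed

lemma finite_cut_of_diverging:
  fixes a :: "nat \<Rightarrow> real"
  assumes "filterlim a at_top sequentially" "Y = a ` {n. n > 0}"
  shows "finite (Y \<inter> {0<..<r})"
proof -
  obtain N where N: "\<And>n. n \<ge> N \<Longrightarrow> r \<le> a n"
    using assms(1) unfolding filterlim_at_top eventually_sequentially by blast
  have "Y \<inter> {0<..<r} \<subseteq> a ` {..<N}"
  proof
    fix y assume y: "y \<in> Y \<inter> {0<..<r}"
    then obtain n where n: "y = a n" using assms(2) by blast
    then have "n < N" using N[of n] y by (cases "n < N") auto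
    then show "y \<in> a ` {..<N}" using n by blast
  qed
  then show ?thesis by (rule finite_subset) simp
qed

lemma AB_HO_discrete_distances:
  assumes X: "Metric_space X d" "AB_HO X d" "distance_set X d \<subseteq> Y \<union> {0}"
    and fin: "\<And>r. finite (Y \<inter> {0<..<r})"
  shows "Heine_Borel_space X d \<and> countable X"
proof
  interpret Metric_space X d by (fact X(1))
  have ball: "finite {x \<in> X. d x0 x < r}" if "x0 \<in> X" for x0 r
    by (rule AB_HO_ball_finite[OF X that fin])
  show "Heine_Borel_space X d"
    unfolding Heine_Borel_space_def
  proof (intro ballI allI)
    fix x r assume x: "x \<in> X"
    have "mcball x r \<subseteq> {y \<in> X. d x y < r + 1}" by auto
    then have "finite (mcball x r)" using ball[OF x] finite_subset by blast
    then show "compactin mtopology (mcball x r)"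
      by (intro finite_imp_compactin) auto
  qed
  show "countable X"
  proof (cases "X = {}")
    case False
    then obtain x0 where "x0 \<in> X" by blast
    then have "countable (\<Union>n. {x \<in> X. d x0 x < real (Suc n)})"
      using ball by (intro countable_UN) (auto intro: countable_finite)
    then show ?thesis using union_balls[of X d x0] by simp
  qed simp
qed


section \<open>Spaces of sets with the first difference as distance\<close>

definition first_diff :: "('a \<Rightarrow> 'a \<Rightarrow> bool) \<Rightarrow> 'a set \<Rightarrow> 'a set \<Rightarrow> 'a \<Rightarrow> bool" where
  "first_diff prec S T \<delta> \<longleftrightarrow> (\<delta> \<in> S) \<noteq> (\<delta> \<in> T) \<and> (\<forall>\<beta>. prec \<beta> \<delta> \<longrightarrow> (\<beta> \<in> S \<longleftrightarrow> \<beta> \<in> T))"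

definition agree_before :: "('a \<Rightarrow> 'a \<Rightarrow> bool) \<Rightarrow> 'a \<Rightarrow> 'a set \<Rightarrow> 'a set \<Rightarrow> bool" where
  "agree_before prec \<alpha> S T \<longleftrightarrow> (\<forall>\<beta>. prec \<beta> \<alpha> \<longrightarrow> (\<beta> \<in> S \<longleftrightarrow> \<beta> \<in> T))"

text \<open>
  Subsets are the branches of a binary tree with one level for each element, and \<open>twist\<close> extends \<open>f\<close>
  from \<open>A\<close> to an automorphism of that tree. At each node it swaps the two children exactly if \<open>f\<close>
  swaps them for some member of \<open>A\<close> through that node; nodes off \<open>A\<close> keep their children.
\<close>

definition twist :: "('a \<Rightarrow> 'a \<Rightarrow> bool) \<Rightarrow> 'a set set \<Rightarrow> ('a set \<Rightarrow> 'a set) \<Rightarrow> 'a set \<Rightarrow> 'a set" where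
  "twist prec A f S =
     {\<alpha>. (\<alpha> \<in> S) \<noteq> (\<exists>a\<in>A. agree_before prec \<alpha> S a \<and> (\<alpha> \<in> f a) \<noteq> (\<alpha> \<in> a))}"

lemma first_diff_iff: "first_diff prec S T \<delta> \<longleftrightarrow> agree_before prec \<delta> S T \<and> (\<delta> \<in> S) \<noteq> (\<delta> \<in> T)"
  unfolding first_diff_def agree_before_def by blast

lemma first_diff_sym: "first_diff prec S T \<delta> \<longleftrightarrow> first_diff prec T S \<delta>"
  unfolding first_diff_def by blast

lemma agree_before_sym: "agree_before prec \<alpha> S T \<longleftrightarrow> agree_before prec \<alpha> T S"
  unfolding agree_before_def by blast

lemma agree_before_trans:
  "agree_before prec \<alpha> S T \<Longrightarrow> agree_before prec \<alpha> T U \<Longrightarrow> agree_before prec \<alpha> S U"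
  unfolding agree_before_def by blast

locale strict_linear =
  fixes prec :: "'a \<Rightarrow> 'a \<Rightarrow> bool"
  assumes prec_irrefl: "\<not> prec a a"
    and prec_trans: "prec a b \<Longrightarrow> prec b c \<Longrightarrow> prec a c"
    and prec_total: "a = b \<or> prec a b \<or> prec b a"
begin

abbreviation fd where "fd \<equiv> first_diff prec"
abbreviation agree where "agree \<equiv> agree_before prec"
abbreviation tw where "tw \<equiv> twist prec"

lemma agree_mono:
  assumes "agree \<alpha> S T" "prec \<beta> \<alpha>"
  shows "agree \<beta> S T"
  using assms(1) prec_trans[OF _ assms(2)] unfolding agree_before_def by blast

lemma first_diff_leI:
  assumes "fd S T \<delta>" "(\<beta> \<in> S) \<noteq> (\<beta> \<in> T)"
  shows "\<beta> = \<delta> \<or> prec \<delta> \<beta>"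
proof -
  have "\<not> prec \<beta> \<delta>" using assms unfolding first_diff_def by blast
  then show ?thesis using prec_total[of \<beta> \<delta>] by simp
qed

lemma first_diff_unique:
  assumes "fd S T \<delta>" "fd S T \<epsilon>"
  shows "\<delta> = \<epsilon>"
proof -
  have "(\<delta> \<in> S) \<noteq> (\<delta> \<in> T)" "(\<epsilon> \<in> S) \<noteq> (\<epsilon> \<in> T)"
    using assms by (simp_all add: first_diff_def)
  then show ?thesis
    using first_diff_leI[OF assms(1), of \<epsilon>] first_diff_leI[OF assms(2), of \<delta>]
      prec_trans[of \<delta> \<epsilon> \<delta>] prec_irrefl by auto
qed

lemma agree_iff_first_diff:
  assumes "fd S T \<delta>"
  shows "agree \<alpha> S T \<longleftrightarrow> \<not> prec \<delta> \<alpha>"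
proof
  assume "agree \<alpha> S T"
  then show "\<not> prec \<delta> \<alpha>" using assms unfolding first_diff_def agree_before_def by blast
next
  assume n: "\<not> prec \<delta> \<alpha>"
  show "agree \<alpha> S T"
    unfolding agree_before_def
  proof (intro allI impI, rule ccontr)
    fix \<beta> assume "prec \<beta> \<alpha>" "(\<beta> \<in> S) \<noteq> (\<beta> \<in> T)"
    then show False using first_diff_leI[OF assms, of \<beta>] n prec_trans[of \<delta> \<beta> \<alpha>] by auto
  qed
qed

lemma twist_mem_cong:
  assumes "agree \<alpha> S T"
  shows "((\<alpha> \<in> tw A f S) \<noteq> (\<alpha> \<in> tw A f T)) \<longleftrightarrow> ((\<alpha> \<in> S) \<noteq> (\<alpha> \<in> T))"
proof -
  have eq: "agree \<alpha> S a \<longleftrightarrow> agree \<alpha> T a" for a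
    using assms unfolding agree_before_def by simp
  show ?thesis unfolding twist_def mem_Collect_eq eq by argo
qed

lemma twist_agree:
  assumes "agree \<alpha> S T"
  shows "agree \<alpha> (tw A f S) (tw A f T)"
  unfolding agree_before_def
proof (intro allI impI)
  fix \<beta> assume \<beta>: "prec \<beta> \<alpha>"
  then have "\<beta> \<in> S \<longleftrightarrow> \<beta> \<in> T" using assms unfolding agree_before_def by blast
  then show "\<beta> \<in> tw A f S \<longleftrightarrow> \<beta> \<in> tw A f T"
    using twist_mem_cong[OF agree_mono[OF assms \<beta>], of A f] by simp
qed

lemma twist_first_diff:
  assumes "fd S T \<delta>"
  shows "fd (tw A f S) (tw A f T) \<delta>"
proof -
  have "agree \<delta> S T" "(\<delta> \<in> S) \<noteq> (\<delta> \<in> T)" using assms by (simp_all add: first_diff_iff)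
  then show ?thesis
    using twist_agree[of \<delta> S T A f] twist_mem_cong[of \<delta> S T A f] by (simp add: first_diff_iff)
qed

end

text \<open>
  This is what an isometric map between two parts of \<open>X\<close> amounts to when the distance is the first
  difference. Injectivity of \<open>f\<close> is included, since distinct members of \<open>X\<close> have a first difference.
\<close>

locale first_diff_isometry = strict_linear prec for prec :: "'a \<Rightarrow> 'a \<Rightarrow> bool" +
  fixes X A :: "'a set set" and f :: "'a set \<Rightarrow> 'a set"
  assumes diff: "S \<in> X \<Longrightarrow> T \<in> X \<Longrightarrow> S \<noteq> T \<Longrightarrow> \<exists>\<delta>. first_diff prec S T \<delta>"
    and AX: "A \<subseteq> X" and fX: "f ` A \<subseteq> X"
    and iso: "a \<in> A \<Longrightarrow> b \<in> A \<Longrightarrow> first_diff prec a b \<delta> \<Longrightarrow> first_diff prec (f a) (f b) \<delta>"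
begin

text \<open>
  All members of \<open>A\<close> through a node require the same decision there: two of them part no earlier
  than at this node, so their images part at it exactly if they do.
\<close>

lemma swap_consistent:
  assumes a: "a \<in> A" "b \<in> A" and ag: "agree \<alpha> a b"
  shows "((\<alpha> \<in> f a) \<noteq> (\<alpha> \<in> a)) \<longleftrightarrow> ((\<alpha> \<in> f b) \<noteq> (\<alpha> \<in> b))"
proof (cases "a = b")
  case False
  then obtain \<delta> where \<delta>: "fd a b \<delta>" using diff a AX by blast
  then have f\<delta>: "fd (f a) (f b) \<delta>" by (rule iso[OF a])
  have "\<not> prec \<delta> \<alpha>" using agree_iff_first_diff[OF \<delta>] ag by blast
  then consider "\<alpha> = \<delta>" | "prec \<alpha> \<delta>" using prec_total[of \<alpha> \<delta>] by blast
  then show ?thesis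
  proof cases
    case 1
    then show ?thesis using \<delta> f\<delta> unfolding first_diff_def by auto
  next
    case 2
    then have "\<alpha> \<in> a \<longleftrightarrow> \<alpha> \<in> b" "\<alpha> \<in> f a \<longleftrightarrow> \<alpha> \<in> f b"
      using \<delta> f\<delta> unfolding first_diff_def by blast+
    then show ?thesis by simp
  qed
qed simp

lemma twist_mem:
  assumes a: "a \<in> A" and ag: "agree \<alpha> S a"
  shows "\<alpha> \<in> tw A f S \<longleftrightarrow> (\<alpha> \<in> S) \<noteq> ((\<alpha> \<in> f a) \<noteq> (\<alpha> \<in> a))"
proof -
  have "(\<exists>b\<in>A. agree \<alpha> S b \<and> (\<alpha> \<in> f b) \<noteq> (\<alpha> \<in> b)) \<longleftrightarrow> (\<alpha> \<in> f a) \<noteq> (\<alpha> \<in> a)"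
  proof
    assume "\<exists>b\<in>A. agree \<alpha> S b \<and> (\<alpha> \<in> f b) \<noteq> (\<alpha> \<in> b)"
    then obtain b where b: "b \<in> A" "agree \<alpha> S b" "(\<alpha> \<in> f b) \<noteq> (\<alpha> \<in> b)" by blast
    have "agree \<alpha> a b"
      using agree_before_trans[OF iffD1[OF agree_before_sym ag] b(2)] .
    then show "(\<alpha> \<in> f a) \<noteq> (\<alpha> \<in> a)" using swap_consistent[OF a b(1)] b(3) by simp
  next
    assume "(\<alpha> \<in> f a) \<noteq> (\<alpha> \<in> a)"
    then show "\<exists>b\<in>A. agree \<alpha> S b \<and> (\<alpha> \<in> f b) \<noteq> (\<alpha> \<in> b)" using a ag by blast
  qed
  then show ?thesis unfolding twist_def mem_Collect_eq by argo
qed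

lemma twist_not_mem:
  "(\<And>a. a \<in> A \<Longrightarrow> \<not> agree \<alpha> S a) \<Longrightarrow> \<alpha> \<in> tw A f S \<longleftrightarrow> \<alpha> \<in> S"
  by (auto simp: twist_def)

lemma twist_extends:
  assumes "a \<in> A"
  shows "tw A f a = f a"
proof -
  have "\<alpha> \<in> tw A f a \<longleftrightarrow> \<alpha> \<in> f a" for \<alpha>
    using twist_mem[OF assms, of \<alpha> a] by (auto simp: agree_before_def)
  then show ?thesis by blast
qed

lemma inj: "inj_on f A"
proof
  fix a b assume ab: "a \<in> A" "b \<in> A" "f a = f b"
  show "a = b"
  proof (rule ccontr)
    assume "a \<noteq> b"
    then obtain \<delta> where "fd a b \<delta>" using diff ab AX by blast
    then have "fd (f a) (f b) \<delta>" by (rule iso[OF ab(1,2)])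
    then show False using ab(3) by (simp add: first_diff_def)
  qed
qed

lemma inverse_isometry: "first_diff_isometry prec X (f ` A) (inv_into A f)"
proof
  show "f ` A \<subseteq> X" by (rule fX)
  show "inv_into A f ` f ` A \<subseteq> X" using AX inj by auto
  show "\<exists>\<delta>. fd S T \<delta>" if "S \<in> X" "T \<in> X" "S \<noteq> T" for S T
    by (rule diff[OF that])
  fix p q \<delta> assume "p \<in> f ` A" "q \<in> f ` A" and \<delta>: "fd p q \<delta>"
  then obtain a b where ab: "a \<in> A" "b \<in> A" "p = f a" "q = f b" by blast
  have "a \<noteq> b" using \<delta> ab by (auto simp: first_diff_def)
  then obtain \<epsilon> where \<epsilon>: "fd a b \<epsilon>" using diff ab AX by blast
  then have "fd p q \<epsilon>" using iso ab by simp
  then have "\<epsilon> = \<delta>" using \<delta> first_diff_unique by blast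
  then show "fd (inv_into A f p) (inv_into A f q) \<delta>"
    using \<epsilon> ab inj by simp
qed

text \<open>
  The twist by the inverse of \<open>f\<close> undoes the twist by \<open>f\<close>: the image of a node on \<open>A\<close> is a node on
  \<open>f ` A\<close>, where the inverse takes the same decision, and the other nodes go to nodes off \<open>f ` A\<close>
  because twisting preserves first differences.
\<close>

lemma twist_inverse:
  assumes S: "S \<in> X"
  shows "tw (f ` A) (inv_into A f) (tw A f S) = S"
proof -
  interpret inv: first_diff_isometry prec X "f ` A" "inv_into A f" by (rule inverse_isometry)
  let ?g = "tw A f"
  have "\<alpha> \<in> tw (f ` A) (inv_into A f) (?g S) \<longleftrightarrow> \<alpha> \<in> S" for \<alpha>
  proof (cases "\<exists>a\<in>A. agree \<alpha> S a")
    case True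
    then obtain a where a: "a \<in> A" "agree \<alpha> S a" by blast
    have "agree \<alpha> (?g S) (f a)"
      using twist_agree[OF a(2)] twist_extends[OF a(1)] by metis
    then show ?thesis
      using inv.twist_mem[of "f a" \<alpha> "?g S"] twist_mem[OF a] a(1) inj by auto
  next
    case False
    have "\<not> agree \<alpha> (?g S) (f a)" if a: "a \<in> A" for a
    proof -
      have "\<not> agree \<alpha> S a" using False a by blast
      then have "S \<noteq> a" by (auto simp: agree_before_def)
      then obtain \<delta> where \<delta>: "fd S a \<delta>" using diff S a AX by blast
      then have "fd (?g S) (f a) \<delta>" using twist_first_diff[OF \<delta>] twist_extends[OF a] by metis
      then show ?thesis
        using agree_iff_first_diff \<delta> \<open>\<not> agree \<alpha> S a\<close> by blast
    qed
    then have "\<alpha> \<in> tw (f ` A) (inv_into A f) (?g S) \<longleftrightarrow> \<alpha> \<in> ?g S"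
      by (intro inv.twist_not_mem) blast
    also have "\<dots> \<longleftrightarrow> \<alpha> \<in> S" using False by (intro twist_not_mem) blast
    finally show ?thesis .
  qed
  then show ?thesis by blast
qed

lemma twist_onto:
  assumes closed: "tw A f ` X \<subseteq> X" and closed': "tw (f ` A) (inv_into A f) ` X \<subseteq> X"
  shows "tw A f ` X = X"
proof
  interpret inv: first_diff_isometry prec X "f ` A" "inv_into A f" by (rule inverse_isometry)
  have A: "inv_into A f ` f ` A = A" using inj by simp
  have eq: "inv_into (f ` A) (inv_into A f) a = f a" if "a \<in> A" for a
  proof -
    have "inv_into (f ` A) (inv_into A f) (inv_into A f (f a)) = f a"
      using inv.inj that by (intro inv_into_f_f) auto
    then show ?thesis using inj that by simp
  qed
  have tw: "tw A (inv_into (f ` A) (inv_into A f)) = tw A f"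
    unfolding twist_def by (rule ext) (simp add: eq cong: bex_cong conj_cong)
  show "X \<subseteq> tw A f ` X"
  proof
    fix T assume T: "T \<in> X"
    have "tw A f (tw (f ` A) (inv_into A f) T) = T"
      using inv.twist_inverse[OF T] unfolding A tw .
    moreover have "tw (f ` A) (inv_into A f) T \<in> X" using closed' T by blast
    ultimately show "T \<in> tw A f ` X" by (metis imageI)
  qed
qed (rule closed)

end


section \<open>Bounded subsets of a set of positive reals\<close>

text \<open>
  The order searches a set of positive reals from the largest values down, but only up to a factor
  of two. This error is what the triangle inequality tolerates, and it is enough to make the order
  a well-order below every bound, however \<open>Y\<close> looks.
\<close>

locale octave_order = strict_linear prec for prec :: "real \<Rightarrow> real \<Rightarrow> bool" +
  assumes prec_less_double: "0 < a \<Longrightarrow> 0 < b \<Longrightarrow> prec a b \<Longrightarrow> b < 2 * a"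
    and has_first: "D \<subseteq> {0<..M} \<Longrightarrow> D \<noteq> {} \<Longrightarrow> \<exists>\<delta>\<in>D. \<forall>\<beta>\<in>D. \<beta> = \<delta> \<or> prec \<delta> \<beta>"

text \<open>
  Higher octaves \<open>[2\<^sup>k, 2\<^sup>k\<^sup>+\<^sup>1)\<close> come first, and each octave is well-ordered by choice. Below a
  bound there is a highest octave and only countably many lower ones, which descend like the
  natural numbers.
\<close>

lemma octave_order_exists: "\<exists>prec. octave_order prec"
proof -
  obtain W :: "real rel" where W: "well_order_on UNIV W" using well_order_on by blast
  then have wf: "wf (W - Id)" and lin: "linear_order_on UNIV W"
    by (simp_all add: well_order_on_def)
  then have W': "trans W" "antisym W" "total W"
    by (simp_all add: linear_order_on_def partial_order_on_def preorder_on_def)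
  define oct :: "real \<Rightarrow> int" where "oct x = \<lfloor>log 2 x\<rfloor>" for x
  define prec where "prec a b \<longleftrightarrow> oct b < oct a \<or> oct a = oct b \<and> (a, b) \<in> W - Id" for a b
  have "octave_order prec"
  proof
    show "\<not> prec a a" for a by (simp add: prec_def)
    show "prec a c" if "prec a b" "prec b c" for a b c
      using that transD[OF trans_diff_Id[OF W'(1,2)], of a b c] unfolding prec_def by auto
    show "a = b \<or> prec a b \<or> prec b a" for a b
      using W'(3) unfolding prec_def total_on_def by auto
    show "b < 2 * a" if ab: "0 < a" "0 < b" "prec a b" for a b
    proof -
      have "oct b \<le> oct a" using ab(3) by (auto simp: prec_def)
      then have "log 2 b < log 2 a + 1" unfolding oct_def by linarith
      also have "\<dots> = log 2 (2 * a)" using ab(1) by (simp add: log_mult)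
      finally show ?thesis using ab by simp
    qed
    fix D :: "real set" and M assume D: "D \<subseteq> {0<..M}" "D \<noteq> {}"
    have le: "oct x \<le> \<lfloor>log 2 M\<rfloor>" if "x \<in> D" for x
    proof -
      have "0 < x" "x \<le> M" using that D(1) by auto
      then show ?thesis unfolding oct_def by (intro floor_mono) simp
    qed
    obtain x0 where "x0 \<in> D" using D(2) by blast
    then obtain x where x: "x \<in> D"
      and min: "\<And>y. y \<in> D \<Longrightarrow> nat (\<lfloor>log 2 M\<rfloor> - oct x) \<le> nat (\<lfloor>log 2 M\<rfloor> - oct y)"
      using ex_has_least_nat[of "\<lambda>x. x \<in> D" x0 "\<lambda>x. nat (\<lfloor>log 2 M\<rfloor> - oct x)"] by blast
    have top: "oct y \<le> oct x" if "y \<in> D" for y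
      using min[OF that] le[OF x] le[OF that] by linarith
    have "x \<in> {y \<in> D. oct y = oct x}" using x by simp
    then obtain \<delta> where \<delta>: "\<delta> \<in> {y \<in> D. oct y = oct x}"
      and least: "\<And>y. (y, \<delta>) \<in> W - Id \<Longrightarrow> y \<notin> {y \<in> D. oct y = oct x}"
      by (rule wfE_min[OF wf]) blast
    have "\<beta> = \<delta> \<or> prec \<delta> \<beta>" if \<beta>: "\<beta> \<in> D" for \<beta>
    proof (cases "oct \<beta> = oct x")
      case True
      then have "(\<beta>, \<delta>) \<notin> W - Id" using least \<beta> by blast
      then have "\<beta> = \<delta> \<or> (\<delta>, \<beta>) \<in> W - Id" using W'(3) unfolding total_on_def by auto
      then show ?thesis using True \<delta> by (auto simp: prec_def)
    next
      case False
      then show ?thesis using top[OF \<beta>] \<delta> by (simp add: prec_def)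
    qed
    then show "\<exists>\<delta>\<in>D. \<forall>\<beta>\<in>D. \<beta> = \<delta> \<or> prec \<delta> \<beta>" using \<delta> by blast
  qed
  then show ?thesis by (rule exI[where P = octave_order])
qed

definition bounded_subsets :: "real set \<Rightarrow> real set set" where
  "bounded_subsets Y = {S. S \<subseteq> Y \<and> bdd_above S}"

text \<open>
  The value is \<open>0\<close> when there is no positive first difference, so that the distance is nonnegative
  and symmetric on all sets of reals.
\<close>

definition first_diff_dist :: "(real \<Rightarrow> real \<Rightarrow> bool) \<Rightarrow> real set \<Rightarrow> real set \<Rightarrow> real" where
  "first_diff_dist prec S T =
     (if \<exists>\<delta>>0. first_diff prec S T \<delta> then THE \<delta>. first_diff prec S T \<delta> else 0)"

locale octave_space = octave_order prec for prec :: "real \<Rightarrow> real \<Rightarrow> bool" +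
  fixes Y :: "real set"
  assumes Y_pos: "Y \<subseteq> {0<..}"
begin

abbreviation X where "X \<equiv> bounded_subsets Y"
abbreviation fddist where "fddist \<equiv> first_diff_dist prec"

lemma memX_pos: "S \<in> X \<Longrightarrow> x \<in> S \<Longrightarrow> 0 < x"
  using Y_pos by (auto simp: bounded_subsets_def)

lemma fddist_eq: "fd S T \<delta> \<Longrightarrow> 0 < \<delta> \<Longrightarrow> fddist S T = \<delta>"
proof -
  assume \<delta>: "fd S T \<delta>" "0 < \<delta>"
  then have "(THE \<epsilon>. fd S T \<epsilon>) = \<delta>"
    using first_diff_unique[OF _ \<delta>(1)] by (intro the_equality)
  moreover have "\<exists>\<epsilon>>0. fd S T \<epsilon>" using \<delta> by blast
  ultimately show ?thesis unfolding first_diff_dist_def by simp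
qed

lemma fddist_refl: "fddist S S = 0"
  by (simp add: first_diff_dist_def first_diff_def)

lemma fddist_sym: "fddist S T = fddist T S"
proof -
  have "fd S T = fd T S" using first_diff_sym[of prec S T] by (intro ext)
  then show ?thesis unfolding first_diff_dist_def by (simp only:)
qed

lemma fddist_nonneg: "0 \<le> fddist S T"
proof (cases "\<exists>\<delta>>0. fd S T \<delta>")
  case True
  then obtain \<delta> where "fd S T \<delta>" "0 < \<delta>" by blast
  then show ?thesis using fddist_eq[of S T \<delta>] by simp
next
  case False
  then show ?thesis unfolding first_diff_dist_def if_not_P[OF False] by simp
qed

lemma first_diff_exists:
  assumes "S \<in> X" "T \<in> X" "S \<noteq> T"
  obtains \<delta> where "fd S T \<delta>" "\<delta> \<in> Y" "0 < \<delta>" "fddist S T = \<delta>"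
proof -
  let ?D = "(S - T) \<union> (T - S)"
  have "bdd_above (S \<union> T)" using assms by (simp add: bounded_subsets_def)
  then obtain M where M: "\<And>x. x \<in> S \<union> T \<Longrightarrow> x \<le> M" unfolding bdd_above_def by blast
  have "?D \<subseteq> {0<..M}" using memX_pos[OF assms(1)] memX_pos[OF assms(2)] M by auto
  moreover have "?D \<noteq> {}" using assms(3) by blast
  ultimately obtain \<delta> where \<delta>: "\<delta> \<in> ?D" and first: "\<And>\<beta>. \<beta> \<in> ?D \<Longrightarrow> \<beta> = \<delta> \<or> prec \<delta> \<beta>"
    using has_first[of ?D M] by blast
  have "fd S T \<delta>"
    unfolding first_diff_def
  proof (intro conjI allI impI)
    show "(\<delta> \<in> S) \<noteq> (\<delta> \<in> T)" using \<delta> by blast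
    fix \<beta> assume \<beta>: "prec \<beta> \<delta>"
    then have "\<not> (\<beta> = \<delta> \<or> prec \<delta> \<beta>)" using prec_irrefl prec_trans[OF \<beta>, of \<beta>] by auto
    then show "\<beta> \<in> S \<longleftrightarrow> \<beta> \<in> T" using first[of \<beta>] by blast
  qed
  moreover have "\<delta> \<in> Y" using \<delta> assms by (auto simp: bounded_subsets_def)
  moreover have "0 < \<delta>" using \<open>\<delta> \<in> Y\<close> Y_pos by auto
  ultimately show thesis using that[of \<delta>] fddist_eq[of S T \<delta>] by simp
qed

text \<open>
  Each point where two sets differ is their first difference or comes after it, where the values are
  less than twice as large. Small distance thus forces agreement on a half-line.
\<close>

lemma difference_less_double:
  assumes "S \<in> X" "T \<in> X" "(\<alpha> \<in> S) \<noteq> (\<alpha> \<in> T)"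
  shows "\<alpha> < 2 * fddist S T"
proof -
  have "S \<noteq> T" using assms(3) by blast
  then obtain \<delta> where \<delta>: "fd S T \<delta>" "0 < \<delta>" "fddist S T = \<delta>"
    using first_diff_exists[OF assms(1,2)] by metis
  have "0 < \<alpha>" using assms(3) memX_pos[OF assms(1)] memX_pos[OF assms(2)] by blast
  then show ?thesis
    using first_diff_leI[OF \<delta>(1) assms(3)] prec_less_double[OF \<delta>(2), of \<alpha>] \<delta>(2,3) by auto
qed

text \<open>
  Of the three first differences in a triangle, the two earliest coincide, and the third is less
  than twice as large.
\<close>

lemma fddist_triangle:
  assumes "S \<in> X" "T \<in> X" "U \<in> X"
  shows "fddist S U \<le> fddist S T + fddist T U"
proof (cases "S = T \<or> T = U \<or> S = U")
  case True
  then show ?thesis using fddist_refl fddist_nonneg[of S T] fddist_nonneg[of T U] by auto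
next
  case False
  obtain a where a: "fd S T a" "0 < a" "fddist S T = a"
    using first_diff_exists[of S T] assms False by metis
  obtain b where b: "fd T U b" "0 < b" "fddist T U = b"
    using first_diff_exists[of T U] assms False by metis
  obtain c where c: "fd S U c" "0 < c" "fddist S U = c"
    using first_diff_exists[of S U] assms False by metis
  have "c \<le> a + b"
  proof -
    consider "a = b" | "prec a b" | "prec b a" using prec_total[of a b] by blast
    then show ?thesis
    proof cases
      case 1
      have "(c \<in> S) \<noteq> (c \<in> U)" using c(1) by (simp add: first_diff_def)
      then have "(c \<in> S) \<noteq> (c \<in> T) \<or> (c \<in> T) \<noteq> (c \<in> U)" by blast
      then have "c = a \<or> prec a c"
        using first_diff_leI[OF a(1), of c] first_diff_leI[OF b(1), of c] 1 by auto
      then show ?thesis using prec_less_double[OF a(2) c(2)] a(2) 1 by auto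
    next
      case 2
      then have "fd S U a"
        using a(1) b(1) prec_trans[OF _ 2] unfolding first_diff_def by simp
      then have "c = a" using first_diff_unique[OF c(1)] by simp
      then show ?thesis using b(2) by simp
    next
      case 3
      then have "fd S U b"
        using a(1) b(1) prec_trans[OF _ 3] unfolding first_diff_def by simp
      then have "c = b" using first_diff_unique[OF c(1)] by simp
      then show ?thesis using a(2) by simp
    qed
  qed
  then show ?thesis using a(3) b(3) c(3) by simp
qed

lemma metric: "Metric_space X fddist"
proof
  show "0 \<le> fddist S T" "fddist S T = fddist T S" for S T
    by (rule fddist_nonneg, rule fddist_sym)
  show "fddist S T = 0 \<longleftrightarrow> S = T" if "S \<in> X" "T \<in> X" for S T
  proof
    show "S = T" if zero: "fddist S T = 0"
    proof (rule ccontr)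
      assume "S \<noteq> T"
      then obtain \<delta> where "0 < \<delta>" "fddist S T = \<delta>"
        using first_diff_exists[OF \<open>S \<in> X\<close> \<open>T \<in> X\<close>] by metis
      then show False using zero by simp
    qed
  qed (simp add: fddist_refl)
  show "fddist S U \<le> fddist S T + fddist T U" if "S \<in> X" "T \<in> X" "U \<in> X" for S T U
    by (rule fddist_triangle[OF that])
qed

lemma distance_set_eq: "distance_set X fddist = Y \<union> {0}"
proof
  show "distance_set X fddist \<subseteq> Y \<union> {0}"
  proof
    fix r assume "r \<in> distance_set X fddist"
    then obtain S T where ST: "S \<in> X" "T \<in> X" "r = fddist S T"
      by (auto simp: distance_set_def)
    show "r \<in> Y \<union> {0}"
    proof (cases "S = T")
      case True
      then show ?thesis using ST(3) fddist_refl by simp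
    next
      case False
      then obtain \<delta> where "\<delta> \<in> Y" "fddist S T = \<delta>"
        using first_diff_exists[OF ST(1,2)] by metis
      then show ?thesis using ST(3) by simp
    qed
  qed
  have empty: "{} \<in> X" by (simp add: bounded_subsets_def)
  have mem: "fddist S T \<in> distance_set X fddist" if "S \<in> X" "T \<in> X" for S T
    unfolding distance_set_def by (rule image_eqI[of _ _ "(S, T)"]) (use that in simp_all)
  show "Y \<union> {0} \<subseteq> distance_set X fddist"
  proof
    fix r assume r: "r \<in> Y \<union> {0}"
    show "r \<in> distance_set X fddist"
    proof (cases "r = 0")
      case True
      then show ?thesis using mem[OF empty empty] by (simp add: fddist_refl)
    next
      case False
      then have Y: "r \<in> Y" "0 < r" using r Y_pos by auto
      then have "{r} \<in> X" by (simp add: bounded_subsets_def)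
      moreover have "fd {r} {} r" using prec_irrefl by (auto simp: first_diff_def)
      then have "fddist {r} {} = r" using Y(2) by (rule fddist_eq)
      ultimately show ?thesis using mem[OF _ empty, of "{r}"] by simp
    qed
  qed
qed

text \<open>
  Two sets at distance less than \<open>e\<close> agree on \<open>[2e, \<infinity>)\<close>, so a Cauchy sequence of sets is eventually
  constant on each such half-line and converges to its pointwise limit.
\<close>

lemma mcomplete: "Metric_space.mcomplete X fddist"
proof -
  interpret Metric_space X fddist by (rule metric)
  show ?thesis
    unfolding mcomplete_def
  proof (intro allI impI)
    fix \<sigma> assume "MCauchy \<sigma>"
    then have "range \<sigma> \<subseteq> X"
      and cauchy: "\<forall>e>0. \<exists>N. \<forall>n m. N \<le> n \<longrightarrow> N \<le> m \<longrightarrow> fddist (\<sigma> n) (\<sigma> m) < e"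
      unfolding MCauchy_def by simp_all
    then have \<sigma>: "\<sigma> n \<in> X" for n by blast
    define L where "L = {\<alpha>. \<exists>N. \<forall>n\<ge>N. \<alpha> \<in> \<sigma> n}"
    have stable: "\<exists>N. \<forall>n\<ge>N. \<forall>\<alpha>\<ge>2 * e. \<alpha> \<in> \<sigma> n \<longleftrightarrow> \<alpha> \<in> L" if e: "0 < e" for e
    proof -
      obtain N where N: "\<And>n m. n \<ge> N \<Longrightarrow> m \<ge> N \<Longrightarrow> fddist (\<sigma> n) (\<sigma> m) < e"
        using cauchy[rule_format, OF e] by blast
      have same: "\<alpha> \<in> \<sigma> n \<longleftrightarrow> \<alpha> \<in> \<sigma> m" if "n \<ge> N" "m \<ge> N" "2 * e \<le> \<alpha>" for n m \<alpha>
      proof (rule ccontr)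
        assume "\<not> ?thesis"
        then have "\<alpha> < 2 * fddist (\<sigma> n) (\<sigma> m)"
          by (intro difference_less_double[OF \<sigma> \<sigma>]) simp
        then show False using N[OF that(1,2)] that(3) by simp
      qed
      have lim: "\<alpha> \<in> \<sigma> n \<longleftrightarrow> \<alpha> \<in> L" if n: "n \<ge> N" and \<alpha>: "2 * e \<le> \<alpha>" for n \<alpha>
      proof
        assume "\<alpha> \<in> \<sigma> n"
        then have "\<forall>m\<ge>N. \<alpha> \<in> \<sigma> m" using same[OF n _ \<alpha>] by simp
        then show "\<alpha> \<in> L" unfolding L_def by blast
      next
        assume "\<alpha> \<in> L"
        then obtain K where "\<And>m. m \<ge> K \<Longrightarrow> \<alpha> \<in> \<sigma> m" unfolding L_def by blast
        then have "\<alpha> \<in> \<sigma> (max N K)" by simp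
        then show "\<alpha> \<in> \<sigma> n" using same[OF n _ \<alpha>, of "max N K"] by simp
      qed
      show ?thesis by (intro exI[of _ N] allI impI lim)
    qed
    have L: "L \<in> X"
    proof -
      have "L \<subseteq> Y"
      proof
        fix \<alpha> assume "\<alpha> \<in> L"
        then obtain N where "\<alpha> \<in> \<sigma> N" unfolding L_def by blast
        then show "\<alpha> \<in> Y" using \<sigma>[of N] by (auto simp: bounded_subsets_def)
      qed
      obtain N where N: "\<And>\<alpha>. 2 \<le> \<alpha> \<Longrightarrow> \<alpha> \<in> \<sigma> N \<longleftrightarrow> \<alpha> \<in> L"
        using stable[of 1] by auto
      obtain M where M: "\<And>\<alpha>. \<alpha> \<in> \<sigma> N \<Longrightarrow> \<alpha> \<le> M"
        using \<sigma>[of N] unfolding bounded_subsets_def bdd_above_def by blast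
      have "\<alpha> \<le> max 2 M" if "\<alpha> \<in> L" for \<alpha>
        using N[of \<alpha>] M[of \<alpha>] that by (cases "2 \<le> \<alpha>") auto
      then have "bdd_above L" unfolding bdd_above_def by blast
      with \<open>L \<subseteq> Y\<close> show ?thesis by (simp add: bounded_subsets_def)
    qed
    have "\<exists>N. \<forall>n\<ge>N. \<sigma> n \<in> X \<and> fddist (\<sigma> n) L < e" if e: "0 < e" for e
    proof -
      have "0 < e / 2" using e by simp
      then obtain N where N: "\<And>n \<alpha>. n \<ge> N \<Longrightarrow> e \<le> \<alpha> \<Longrightarrow> \<alpha> \<in> \<sigma> n \<longleftrightarrow> \<alpha> \<in> L"
        using stable[of "e / 2"] by auto
      have "fddist (\<sigma> n) L < e" if n: "n \<ge> N" for n
      proof (cases "\<sigma> n = L")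
        case True
        then show ?thesis using e fddist_refl by simp
      next
        case False
        then obtain \<delta> where \<delta>: "fd (\<sigma> n) L \<delta>" "fddist (\<sigma> n) L = \<delta>"
          using first_diff_exists[OF \<sigma> L] by metis
        have "(\<delta> \<in> \<sigma> n) \<noteq> (\<delta> \<in> L)" using \<delta>(1) by (simp add: first_diff_def)
        then have "\<not> e \<le> \<delta>" using N[OF n, of \<delta>] by blast
        then show ?thesis using \<delta>(2) by simp
      qed
      then show ?thesis using \<sigma> by (intro exI[of _ N]) simp
    qed
    then show "\<exists>L. limitin mtopology \<sigma> L sequentially"
      unfolding limit_metric_sequentially using L by (intro exI[of _ L]) simp
  qed
qed

text \<open>
  A twist does not create large elements. Take \<open>a\<close> in \<open>A\<close> and \<open>\<alpha>\<close> more than twice as large as all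
  elements of \<open>S\<close>, \<open>a\<close> and \<open>f a\<close>. Everything before \<open>\<alpha>\<close> is then also above these three sets, so
  \<open>S\<close> passes through the same node at \<open>\<alpha>\<close> as \<open>a\<close>, and \<open>f\<close> does not swap the children there.
\<close>

lemma twist_closed:
  assumes "first_diff_isometry prec X A f"
  shows "tw A f ` X \<subseteq> X"
proof
  interpret first_diff_isometry prec X A f by (fact assms)
  fix T assume "T \<in> tw A f ` X"
  then obtain S where S: "S \<in> X" and T: "T = tw A f S" by blast
  show "T \<in> X"
  proof (cases "A = {}")
    case True
    then have "T = S" unfolding T twist_def by simp
    then show ?thesis using S by simp
  next
    case False
    then obtain a where a: "a \<in> A" by blast
    have aX: "a \<in> X" "f a \<in> X" using a AX fX by auto
    have "bdd_above (S \<union> a \<union> f a)" using S aX by (simp add: bounded_subsets_def)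
    then obtain M where M: "\<And>x. x \<in> S \<union> a \<union> f a \<Longrightarrow> x \<le> M" unfolding bdd_above_def by blast
    have sub: "T \<subseteq> Y"
    proof
      fix \<alpha> assume "\<alpha> \<in> T"
      then have "\<alpha> \<in> S \<or> (\<exists>b\<in>A. \<alpha> \<in> f b \<or> \<alpha> \<in> b)" unfolding T twist_def by blast
      moreover have "U \<subseteq> Y" if "U \<in> X" for U using that by (simp add: bounded_subsets_def)
      ultimately show "\<alpha> \<in> Y" using S AX fX by blast
    qed
    have "\<alpha> \<le> 2 * max 1 M" if \<alpha>: "\<alpha> \<in> T" for \<alpha>
    proof (rule ccontr)
      assume "\<not> \<alpha> \<le> 2 * max 1 M"
      then have big: "2 * M < \<alpha>" "M < \<alpha>" "0 < \<alpha>" by auto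
      have out: "\<beta> \<notin> S \<union> a \<union> f a" if "prec \<beta> \<alpha>" for \<beta>
      proof
        assume \<beta>: "\<beta> \<in> S \<union> a \<union> f a"
        then have "0 < \<beta>" using memX_pos[OF S] memX_pos[OF aX(1)] memX_pos[OF aX(2)] by blast
        then have "\<alpha> < 2 * \<beta>" using prec_less_double[OF _ big(3) that] by simp
        then show False using M[OF \<beta>] big(1) by simp
      qed
      then have "agree \<alpha> S a" unfolding agree_before_def by blast
      moreover have "\<alpha> \<notin> S" "\<alpha> \<notin> a" "\<alpha> \<notin> f a" using M[of \<alpha>] big(2) by auto
      ultimately have "\<alpha> \<notin> T" unfolding T using twist_mem[OF a] by simp
      then show False using \<alpha> by simp
    qed
    then have "bdd_above T" unfolding bdd_above_def by blast
    with sub show ?thesis by (simp add: bounded_subsets_def)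
  qed
qed

lemma AB_HO: "AB_HO X fddist"
  unfolding AB_HO_def
proof (intro allI impI)
  fix A f assume "A \<subseteq> X \<and> f ` A \<subseteq> X \<and> isometric_on A fddist f"
  then have A: "A \<subseteq> X" "f ` A \<subseteq> X" and iso: "isometric_on A fddist f" by auto
  interpret f: first_diff_isometry prec X A f
  proof
    show "\<exists>\<delta>. fd S T \<delta>" if "S \<in> X" "T \<in> X" "S \<noteq> T" for S T
      using first_diff_exists[OF that] by metis
    show "A \<subseteq> X" "f ` A \<subseteq> X" by (fact A)+
    fix a b \<delta> assume ab: "a \<in> A" "b \<in> A" and \<delta>: "fd a b \<delta>"
    have X: "a \<in> X" "b \<in> X" "f a \<in> X" "f b \<in> X" using ab A by auto
    have ne: "(\<delta> \<in> a) \<noteq> (\<delta> \<in> b)" using \<delta> by (simp add: first_diff_def)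
    then have pos: "0 < \<delta>" using memX_pos[OF X(1)] memX_pos[OF X(2)] by blast
    have d: "fddist (f a) (f b) = \<delta>"
      using iso ab fddist_eq[OF \<delta> pos] unfolding isometric_on_def by simp
    then have "f a \<noteq> f b" using pos fddist_refl by force
    then obtain \<epsilon> where "fd (f a) (f b) \<epsilon>" "fddist (f a) (f b) = \<epsilon>"
      using first_diff_exists[OF X(3,4)] by metis
    then show "fd (f a) (f b) \<delta>" using d by simp
  qed
  show "\<exists>g. g ` X = X \<and> isometric_on X fddist g \<and> (\<forall>a\<in>A. g a = f a)"
  proof (intro exI conjI ballI)
    show "tw A f ` X = X"
      by (rule f.twist_onto[OF twist_closed[OF f.first_diff_isometry_axioms]
            twist_closed[OF f.inverse_isometry]])
    show "tw A f a = f a" if "a \<in> A" for a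
      by (rule f.twist_extends[OF that])
    show "isometric_on X fddist (tw A f)"
      unfolding isometric_on_def
    proof (intro ballI)
      fix S T assume ST: "S \<in> X" "T \<in> X"
      show "fddist (tw A f S) (tw A f T) = fddist S T"
      proof (cases "S = T")
        case True
        then show ?thesis by (simp add: fddist_refl)
      next
        case False
        then obtain \<delta> where \<delta>: "fd S T \<delta>" "0 < \<delta>" "fddist S T = \<delta>"
          using first_diff_exists[OF ST] by metis
        show ?thesis using fddist_eq[OF twist_first_diff[OF \<delta>(1)] \<delta>(2)] \<delta>(3) by simp
      qed
    qed
  qed
qed

lemma card:
  assumes "infinite Y"
  shows "|X| =o mY Y"
proof -
  have cut: "Y \<inter> {0<..<r} = {y \<in> Y. y < r}" for r using Y_pos by auto
  have Pow_sub: "Pow (Y \<inter> {0<..<r}) \<subseteq> X" for r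
  proof
    fix S assume "S \<in> Pow (Y \<inter> {0<..<r})"
    then have "S \<subseteq> Y" "\<And>x. x \<in> S \<Longrightarrow> x \<le> r" by force+
    then show "S \<in> X" unfolding bounded_subsets_def bdd_above_def by blast
  qed
  have "X \<subseteq> (\<Union>n. Pow (Y \<inter> {0<..<real (Suc n)}))"
  proof
    fix S assume S: "S \<in> X"
    then obtain M where M: "\<And>x. x \<in> S \<Longrightarrow> x \<le> M" "S \<subseteq> Y"
      unfolding bounded_subsets_def bdd_above_def by blast
    obtain n where n: "M < real n" using reals_Archimedean2 by blast
    have "x < real (Suc n)" if "x \<in> S" for x using M(1)[OF that] n by simp
    then have "S \<in> Pow (Y \<inter> {0<..<real (Suc n)})" unfolding cut using M(2) by blast
    then show "S \<in> (\<Union>n. Pow (Y \<inter> {0<..<real (Suc n)}))" by blast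
  qed
  then have "|X| \<le>o |\<Union>n. Pow (Y \<inter> {0<..<real (Suc n)})|" by (rule card_of_mono1)
  also have "|\<Union>n. Pow (Y \<inter> {0<..<real (Suc n)})| \<le>o mY Y"
    by (intro countable_union_le_mY[OF assms Y_pos] ctwo_power_le_mY) simp
  finally have le: "|X| \<le>o mY Y" .
  have "mY Y \<le>o |X|"
  proof (rule mY_least[OF card_of_Card_order])
    fix r assume "r \<in> mY_powers Y"
    then obtain n :: nat where r: "r = ctwo ^c |Y \<inter> {0<..<real n}|"
      unfolding mY_powers_def by blast
    show "r \<le>o |X|"
      unfolding r
      by (rule ordIso_ordLeq_trans[OF ordIso_symmetric[OF Pow_cexp_ctwo] card_of_mono1[OF Pow_sub]])
  qed
  with le show ?thesis by (simp add: ordIso_iff_ordLeq)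
qed

end

lemma AB_HO_space_exists:
  assumes "infinite Y" "Y \<subseteq> {0<..}"
  shows "\<exists>(X :: real set set) d. Metric_space X d \<and> AB_HO X d \<and> Metric_space.mcomplete X d \<and>
    distance_set X d = Y \<union> {0} \<and> |X| =o mY Y"
proof -
  obtain prec where "octave_order prec" using octave_order_exists by blast
  then interpret octave_space prec Y
    using assms(2) by (simp add: octave_space_def octave_space_axioms_def)
  show ?thesis using metric AB_HO mcomplete distance_set_eq card[OF assms(1)] by blast
qed

lemma AB_HO_space_exists_power:
  assumes "infinite Y" "Y \<subseteq> {0<..}" "|Y \<inter> {0<..<c}| =o |Y|"
  shows "\<exists>(X :: real set set) d. Metric_space X d \<and> AB_HO X d \<and> Metric_space.mcomplete X d \<and>
    distance_set X d = Y \<union> {0} \<and> |X| =o ctwo ^c |Y|"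
  using AB_HO_space_exists[OF assms(1,2)] ordIso_transitive[OF _ mY_eq_power[OF assms(3)]] by blast


section \<open>Sets of reals of the cardinality of the continuum\<close>

text \<open>
  This is Koenig's argument that the continuum has uncountable cofinality. Decode the points of \<open>Y\<close>
  as all sequences of sets of naturals. If each cut \<open>Y \<inter> (0, n + 1)\<close> were smaller than the
  continuum, its points would miss some \<open>t n\<close> at place \<open>n\<close>, and the sequence \<open>t\<close> would lie in no
  cut.
\<close>

lemma continuum_cut:
  fixes Y :: "real set"
  assumes Y: "Y \<subseteq> {0<..}" and card: "|Y| =o ctwo ^c |UNIV :: nat set|"
  shows "\<exists>c>0. |Y \<inter> {0<..<c}| =o |Y|"
proof (rule ccontr)
  assume no: "\<not> ?thesis"
  let ?Y = "\<lambda>n :: nat. Y \<inter> {0<..<real (Suc n)}"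
  have "|Pow (UNIV :: nat set)| =o ctwo ^c |UNIV :: nat set|" by (rule Pow_cexp_ctwo)
  then have iso: "|Y| =o |UNIV :: nat set set|"
    using ordIso_transitive[OF card ordIso_symmetric] by simp
  then obtain h where h: "bij_betw h Y (UNIV :: nat set set)"
    using iffD2[OF card_of_ordIso] by blast
  have less: "|?Y n| <o |UNIV :: nat set set|" for n
  proof -
    have "|?Y n| \<le>o |Y|" by (rule card_of_mono1) blast
    moreover have "\<not> |?Y n| =o |Y|" using no by simp
    ultimately have "|?Y n| <o |Y|" by (simp add: ordLeq_iff_ordLess_or_ordIso)
    then show ?thesis using iso by (rule ordLess_ordIso_trans)
  qed
  define \<phi> where "\<phi> y n = {m. prod_encode (n, m) \<in> h y}" for y n
  have "\<exists>t. t \<notin> (\<lambda>y. \<phi> y n) ` ?Y n" for n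
  proof (rule ccontr)
    assume "\<not> ?thesis"
    then have "(\<lambda>y. \<phi> y n) ` ?Y n = UNIV" by blast
    then have "|UNIV :: nat set set| \<le>o |?Y n|" using card_of_image[of "\<lambda>y. \<phi> y n" "?Y n"] by simp
    then show False using less[of n] not_ordLess_ordLeq by blast
  qed
  then obtain t where t: "\<And>n. t n \<notin> (\<lambda>y. \<phi> y n) ` ?Y n" by metis
  have "{prod_encode (n, m) | n m. m \<in> t n} \<in> h ` Y" using h by (simp add: bij_betw_def)
  then obtain y where y: "y \<in> Y" "h y = {prod_encode (n, m) | n m. m \<in> t n}" by force
  have \<phi>: "\<phi> y n = t n" for n unfolding \<phi>_def y(2) by auto
  obtain n where n: "y < real n" using reals_Archimedean2 by blast
  have "y \<in> ?Y n" using y(1) Y n by auto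
  then show False using t[of n] \<phi>[of n] by blast
qed



section \<open>Cardinalities of absolutely homogeneous spaces\<close>

theorem theorem4p10:
  shows
  "(\<forall>Y :: real set. infinite Y \<and> Y \<subseteq> {0<..} \<longrightarrow>
      (\<forall>(X :: 'a set) d. Metric_space X d \<and> AB_HO X d \<and> distance_set X d \<subseteq> Y \<union> {0}
         \<longrightarrow> |X| \<le>o mY Y) \<and>
      (\<exists>(X :: real set set) d. Metric_space X d \<and> AB_HO X d \<and> Metric_space.mcomplete X d \<and>
         distance_set X d = Y \<union> {0} \<and> |X| =o mY Y))
   \<and>
   (\<forall>Y :: real set. infinite Y \<and> Y \<subseteq> {0<..} \<and> bounded Y \<longrightarrow>
      (\<exists>(X :: real set set) d. Metric_space X d \<and> AB_HO X d \<and> Metric_space.mcomplete X d \<and>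
         distance_set X d = Y \<union> {0} \<and> |X| =o BNF_Cardinal_Arithmetic.ctwo ^c |Y| ))
   \<and>
   (\<forall>Y :: real set. infinite Y \<and> Y \<subseteq> {0<..} \<and> (\<exists>c>0. |Y \<inter> {0<..<c}| =o |Y| ) \<longrightarrow>
      (\<exists>(X :: real set set) d. Metric_space X d \<and> AB_HO X d \<and> Metric_space.mcomplete X d \<and>
         distance_set X d = Y \<union> {0} \<and> |X| =o BNF_Cardinal_Arithmetic.ctwo ^c |Y| ))
   \<and>
   (\<forall>Y :: real set. Y \<subseteq> {0<..} \<and> |Y| =o BNF_Cardinal_Arithmetic.ctwo ^c |UNIV :: nat set| \<longrightarrow>
      (\<exists>c>0. |Y \<inter> {0<..<c}| =o |Y| ))
   \<and>
   (\<forall>Y :: real set. infinite Y \<and>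
      (\<exists>a :: nat \<Rightarrow> real. (\<forall>n>0. a n > 0) \<and> Y = a ` {n. n > 0} \<and> filterlim a at_top sequentially)
      \<longrightarrow>
      (\<forall>(X :: 'a set) d. Metric_space X d \<and> AB_HO X d \<and> distance_set X d \<subseteq> Y \<union> {0}
         \<longrightarrow> Heine_Borel_space X d \<and> countable X))"
proof (intro conjI allI impI; (elim conjE)?)
  fix Y :: "real set" and X :: "'a set" and d
  assume "infinite Y" "Y \<subseteq> {0<..}" "Metric_space X d" "AB_HO X d" "distance_set X d \<subseteq> Y \<union> {0}"
  then show "|X| \<le>o mY Y" by (rule AB_HO_card_le_mY)
next
  fix Y :: "real set"
  assume "infinite Y" "Y \<subseteq> {0<..}"
  then show "\<exists>(X :: real set set) d. Metric_space X d \<and> AB_HO X d \<and> Metric_space.mcomplete X d \<and>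
      distance_set X d = Y \<union> {0} \<and> |X| =o mY Y"
    by (rule AB_HO_space_exists)
next
  fix Y :: "real set"
  assume Y: "infinite Y" "Y \<subseteq> {0<..}" and "bounded Y"
  then obtain b where b: "\<And>y. y \<in> Y \<Longrightarrow> \<bar>y\<bar> \<le> b" unfolding bounded_real by blast
  have "Y \<inter> {0<..<b + 1} = Y" using Y(2) b by force
  then have "|Y \<inter> {0<..<b + 1}| =o |Y|" by (simp add: card_of_refl)
  then show "\<exists>(X :: real set set) d. Metric_space X d \<and> AB_HO X d \<and> Metric_space.mcomplete X d \<and>
      distance_set X d = Y \<union> {0} \<and> |X| =o ctwo ^c |Y|"
    by (rule AB_HO_space_exists_power[OF Y])
next
  fix Y :: "real set"
  assume Y: "infinite Y" "Y \<subseteq> {0<..}" and "\<exists>c>0. |Y \<inter> {0<..<c}| =o |Y|"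
  then obtain c where "|Y \<inter> {0<..<c}| =o |Y|" by blast
  then show "\<exists>(X :: real set set) d. Metric_space X d \<and> AB_HO X d \<and> Metric_space.mcomplete X d \<and>
      distance_set X d = Y \<union> {0} \<and> |X| =o ctwo ^c |Y|"
    by (rule AB_HO_space_exists_power[OF Y])
next
  fix Y :: "real set"
  assume "Y \<subseteq> {0<..}" "|Y| =o ctwo ^c |UNIV :: nat set|"
  then show "\<exists>c>0. |Y \<inter> {0<..<c}| =o |Y|" by (rule continuum_cut)
next
  fix Y :: "real set" and X :: "'a set" and d
  assume a: "\<exists>a. (\<forall>n>0. a n > 0) \<and> Y = a ` {n. n > 0} \<and> filterlim a at_top sequentially"
    and X: "Metric_space X d" "AB_HO X d" "distance_set X d \<subseteq> Y \<union> {0}"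
  have "finite (Y \<inter> {0<..<r})" for r
    using a finite_cut_of_diverging by blast
  from AB_HO_discrete_distances[OF X this]
  show "Heine_Borel_space X d" "countable X" by blast+
qed

end
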